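(* Let $F$ be a self-similar set in $\mathbb{R}^d$ satisfying OSC, with similarity dimension $D<d$. Then there exists a strong feasible open set $O$ for $F$ such that the average Minkowski content (and, in case it exists, also the Minkowski content $\mathcal{M}^D(F)$) of $F$ is given by the formula $$\widetilde{\mathcal{M}}^D(F)=\frac1\eta\int_0^\infty\varepsilon^{D-d-1}\lambda_d(F_\varepsilon\cap\Gamma)\,d\varepsilon,$$ where $\Gamma:=O\setminus\mathbf{S}O$ and $\eta=-\sum_{i=1}^N r_i^D\ln r_i$.
   Context: $N\ge2$, $S_1,\dots,S_N:\mathbb{R}^d\to\mathbb{R}^d$ are contracting similarities with ratios $r_i\in(0,1)$ (an IFS), $\mathbf{S}(A):=\bigcup_{i=1}^N S_i(A)$, and the self-similar set $F$ is the unique nonempty compact set with $\mathbf{S}F=F$. The similarity dimension $D$ is the unique real solution of $\sum_{i=1}^N r_i^D=1$. A feasible open set for $F$ is a nonempty bounded open set $O$ with $S_iO\subset O$ for all $i$ and $S_iO\cap S_jO=\emptyset$ for $i\ne j$; OSC means that one exists; $O$ is strong if $O\cap F\ne\emptyset$. $\lambda_d$ is Lebesgue measure and $F_\varepsilon:=\{z\in\mathbb{R}^d:\inf_{a\in F}|a-z|\le\varepsilon\}$. $\mathcal{M}^D(F):=\lim_{\varepsilon\searrow0}\varepsilon^{D-d}\lambda_d(F_\varepsilon)$ (if the limit exists) and $\widetilde{\mathcal{M}}^D(F):=\lim_{\delta\searrow0}\frac1{|\ln\delta|}\int_\delta^1\varepsilon^{D-d}\lambda_d(F_\varepsilon)\frac{d\varepsilon}{\varepsilon}$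 (this limit always exists under OSC). *)

theory Defs
  imports "HOL-Analysis.Analysis"
begin

definition contracting_similarity ::
    "real \<Rightarrow> (real ^ 'd \<Rightarrow> real ^ 'd) \<Rightarrow> bool" where
  "contracting_similarity q f \<longleftrightarrow>
     0 < q \<and> q < 1 \<and> (\<forall>x y. dist (f x) (f y) = q * dist x y)"

text \<open>The maps of an iterated function system are \<open>S 1, \<dots>, S N\<close>; the values of \<open>S\<close> and \<open>r\<close> at
  other indices are irrelevant throughout.\<close>

definition similarity_ifs ::
    "nat \<Rightarrow> (nat \<Rightarrow> real ^ 'd \<Rightarrow> real ^ 'd) \<Rightarrow> (nat \<Rightarrow> real) \<Rightarrow> bool" where
  "similarity_ifs N S r \<longleftrightarrow> N \<ge> 2 \<and> (\<forall>i\<in>{1..N}. contracting_similarity (r i) (S i))"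

definition ifs_image ::
    "nat \<Rightarrow> (nat \<Rightarrow> real ^ 'd \<Rightarrow> real ^ 'd) \<Rightarrow> (real ^ 'd) set \<Rightarrow> (real ^ 'd) set" where
  "ifs_image N S A = (\<Union>i\<in>{1..N}. S i ` A)"

text \<open>For a similarity IFS exactly one set satisfies the next predicate (Hutchinson) and exactly
  one real number satisfies the one after it (Moran's equation).\<close>

definition self_similar_set ::
    "nat \<Rightarrow> (nat \<Rightarrow> real ^ 'd \<Rightarrow> real ^ 'd) \<Rightarrow> (real ^ 'd) set \<Rightarrow> bool" where
  "self_similar_set N S F \<longleftrightarrow> F \<noteq> {} \<and> compact F \<and> ifs_image N S F = F"

definition similarity_dimension :: "nat \<Rightarrow> (nat \<Rightarrow> real) \<Rightarrow> real \<Rightarrow> bool" where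
  "similarity_dimension N r D \<longleftrightarrow> (\<Sum>i=1..N. r i powr D) = 1"

definition feasible_open_set ::
    "nat \<Rightarrow> (nat \<Rightarrow> real ^ 'd \<Rightarrow> real ^ 'd) \<Rightarrow> (real ^ 'd) set \<Rightarrow> bool" where
  "feasible_open_set N S U \<longleftrightarrow>
     open U \<and> U \<noteq> {} \<and> bounded U \<and>
     (\<forall>i\<in>{1..N}. S i ` U \<subseteq> U) \<and>
     (\<forall>i\<in>{1..N}. \<forall>j\<in>{1..N}. i \<noteq> j \<longrightarrow> S i ` U \<inter> S j ` U = {})"

definition open_set_condition ::
    "nat \<Rightarrow> (nat \<Rightarrow> real ^ 'd \<Rightarrow> real ^ 'd) \<Rightarrow> bool" where
  "open_set_condition N S \<longleftrightarrow> (\<exists>U. feasible_open_set N S U)"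

definition strong_feasible_open_set ::
    "nat \<Rightarrow> (nat \<Rightarrow> real ^ 'd \<Rightarrow> real ^ 'd) \<Rightarrow> (real ^ 'd) set \<Rightarrow> (real ^ 'd) set \<Rightarrow> bool" where
  "strong_feasible_open_set N S F U \<longleftrightarrow> feasible_open_set N S U \<and> U \<inter> F \<noteq> {}"

definition parallel_set :: "(real ^ 'd) set \<Rightarrow> real \<Rightarrow> (real ^ 'd) set" where
  "parallel_set F \<epsilon> = {z. infdist z F \<le> \<epsilon>}"

text \<open>The contents are limits in the extended reals, so \<open>\<infinity>\<close> is admitted as a value.\<close>

definition has_minkowski_content :: "real \<Rightarrow> (real ^ 'd) set \<Rightarrow> ereal \<Rightarrow> bool" where
  "has_minkowski_content D F M \<longleftrightarrow>
     ((\<lambda>\<epsilon>. ereal (\<epsilon> powr (D - real CARD('d)) * measure lebesgue (parallel_set F \<epsilon>))) \<longlongrightarrow> M)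
       (at_right 0)"

definition has_average_minkowski_content :: "real \<Rightarrow> (real ^ 'd) set \<Rightarrow> ereal \<Rightarrow> bool" where
  "has_average_minkowski_content D F M \<longleftrightarrow>
     ((\<lambda>\<delta>. ereal (1 / \<bar>ln \<delta>\<bar> *
          (LINT \<epsilon>:{\<delta>..1}|lborel.
             \<epsilon> powr (D - real CARD('d)) * measure lebesgue (parallel_set F \<epsilon>) / \<epsilon>))) \<longlongrightarrow> M)
       (at_right 0)"

end

theory Submission
  imports Defs
begin

text \<open>Write \<open>d\<close> for the dimension of the space, \<open>\<lambda>\<close> for Lebesgue
measure and \<open>F\<^sub>\<epsilon>\<close> for the parallel set. The theorem holds for every feasible
open set \<open>U\<close> with two further properties: \<open>U\<close> contains a whole cylinder of
\<open>F\<close>, and every point of \<open>S i ` U\<close> is as far from \<open>F\<close> as from the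
piece \<open>S i ` F\<close>. A bounded part of the central open set, the points closer to
\<open>F\<close> than to all neighbour sets, has them (\<open>strong_open_set_with_projection\<close>).
What has to be shown for this is that some cylinder of \<open>F\<close> keeps a positive distance from
all neighbour sets, and this follows from the open set condition by Schief's argument: a cylinder of
given size has boundedly many neighbours of similar size, and one with the maximal number of neighbours
is separated from all pieces with a different first letter (\<open>separated_cylinder\<close>).

Given such a \<open>U\<close>, put \<open>v(\<epsilon>) = \<lambda>(F\<^sub>\<epsilon> \<inter>
U)\<close> and \<open>g(\<epsilon>) = \<lambda>(F\<^sub>\<epsilon> \<inter> \<Gamma>)\<close> with
\<open>\<Gamma>\<close> the part of \<open>U\<close> outside its images. The second property of
\<open>U\<close> makes the parallel set inside \<open>S i ` U\<close> a scaled copy of the one inside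
\<open>U\<close>, so \<open>v(\<epsilon>)\<close> is the sum of \<open>r i ^ d * v(\<epsilon> / r
i)\<close> over \<open>i\<close>, plus \<open>g(\<epsilon>)\<close> (\<open>volume_renewal\<close>). Let
\<open>\<Phi>(\<delta>)\<close> be the integral of \<open>\<epsilon> powr (D - d - 1) *
v(\<epsilon>)\<close> from \<open>\<delta>\<close> to infinity. Then \<open>\<Phi>(\<delta>)\<close>
minus the sum of \<open>r i powr D * \<Phi>(\<delta> / r i)\<close> is the integral of \<open>\<epsilon>
powr (D - d - 1) * g(\<epsilon>)\<close> from \<open>\<delta>\<close> to infinity, which converges to the
full integral \<open>G\<close>. As \<open>\<Phi>\<close> is monotone and the weights \<open>r i powr
D\<close> add up to \<open>1\<close>, comparison with a linear function of \<open>- ln \<delta>\<close>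
shows that \<open>\<Phi>(\<delta>)\<close> divided by \<open>\<bar>ln \<delta>\<bar>\<close> tends to
\<open>G / \<eta>\<close> (\<open>elementary_renewal\<close>). Working with integrated volumes reduces
the renewal theorem to this elementary form, the same for lattice and non-lattice ratios.

Two points remain: \<open>G\<close> is finite, and the volume of \<open>F\<^sub>\<epsilon>\<close>
outside \<open>U\<close> does not affect the average. Both follow from the integrability near
\<open>0\<close> of \<open>\<epsilon> powr (D - d - 1) * \<lambda>(F\<^sub>\<epsilon> - U)\<close>. The
volume outside \<open>U\<close> satisfies a renewal inequality over the words of the length of
\<open>k\<close>, where \<open>k\<close> is the word of the cylinder inside \<open>U\<close>; this
cylinder drops out, so the weights add up to less than \<open>1\<close>
(\<open>volume_outside_le\<close>, \<open>subcritical_renewal_integrable\<close>). Finally, a Minkowski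
content, if it exists, equals the average one, because the logarithmic mean of a convergent function
converges to the same limit (\<open>log_average_eq_limit\<close>).\<close>

section \<open>Similarities of Euclidean space\<close>

text \<open>Unlike \<^const>\<open>contracting_similarity\<close>, the ratio may be \<open>1\<close>, so
that the maps of all words, the empty one included, are similarities.\<close>

definition similarity :: "real \<Rightarrow> ('a::metric_space \<Rightarrow> 'a) \<Rightarrow> bool" where
  "similarity q f \<longleftrightarrow> 0 < q \<and> (\<forall>x y. dist (f x) (f y) = q * dist x y)"

lemma similarity_pos: "similarity q f \<Longrightarrow> 0 < q"
  and similarity_dist: "similarity q f \<Longrightarrow> dist (f x) (f y) = q * dist x y"
  by (auto simp: similarity_def)

lemma similarity_inj: "similarity q f \<Longrightarrow> inj f"
  by (rule injI) (metis similarity_dist similarity_pos dist_eq_0_iff mult_eq_0_iff less_irrefl)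

lemma similarity_id: "similarity 1 id"
  by (simp add: similarity_def)

lemma similarity_comp: "similarity p f \<Longrightarrow> similarity q g \<Longrightarrow> similarity (p * q) (f \<circ> g)"
  by (simp add: similarity_def)

lemma similarity_infdist:
  assumes "similarity q f"
  shows "infdist (f x) (f ` A) = q * infdist x A"
proof (cases "A = {}")
  case False
  have le: "infdist (f x) (f ` A) \<le> q * dist x a" if "a \<in> A" for a
    using infdist_le[of "f a" "f ` A" "f x"] that similarity_dist[OF assms] by simp
  have q: "q > 0" using assms similarity_pos by blast
  have "q * infdist x A \<le> infdist (f x) (f ` A)"
    unfolding infdist_notempty[of "f ` A", simplified, OF False]
  proof (rule cINF_greatest)
    show "f ` A \<noteq> {}" using False by simp
    fix y assume "y \<in> f ` A"
    then obtain a where "a \<in> A" "y = f a" by blast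
    then show "q * infdist x A \<le> dist (f x) y"
      using infdist_le[of a A x] q by (simp add: similarity_dist[OF assms])
  qed
  moreover have "infdist (f x) (f ` A) / q \<le> infdist x A"
    unfolding infdist_notempty[of A, OF False]
  proof (rule cINF_greatest[OF False])
    fix a assume "a \<in> A"
    then show "infdist (f x) (f ` A) / q \<le> dist x a"
      using le[of a] q by (simp add: divide_simps mult.commute)
  qed
  ultimately show ?thesis using q by (simp add: divide_simps mult.commute)
qed (simp add: infdist_def)

text \<open>After translating \<open>f 0\<close> to the origin and dividing by \<open>q\<close> an
isometry fixing the origin remains. Its linearity is what makes similarities surjective.\<close>

lemma similarity_affine:
  fixes f :: "real ^ 'd \<Rightarrow> real ^ 'd"
  assumes "similarity q f"
  obtains g where "orthogonal_transformation g" and "f = (\<lambda>x. f 0 + q *\<^sub>R g x)"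
proof
  let ?g = "\<lambda>x. (1 / q) *\<^sub>R (f x - f 0)"
  have q: "q > 0" using assms similarity_pos by blast
  have "dist (?g x) (?g y) = dist x y" for x y
  proof -
    have "?g x - ?g y = (1 / q) *\<^sub>R (f x - f y)" by (simp add: algebra_simps)
    then have "dist (?g x) (?g y) = (1 / q) * dist (f x) (f y)"
      using q by (simp add: dist_norm)
    then show ?thesis using q by (simp add: similarity_dist[OF assms])
  qed
  then show "orthogonal_transformation ?g"
    by (simp add: orthogonal_transformation_isometry)
  show "f = (\<lambda>x. f 0 + q *\<^sub>R ?g x)" using q by (auto simp: fun_eq_iff)
qed

lemma similarity_surj:
  fixes f :: "real ^ 'd \<Rightarrow> real ^ 'd"
  assumes "similarity q f"
  shows "surj f"
proof -
  obtain g where g: "orthogonal_transformation g" and f: "f = (\<lambda>x. f 0 + q *\<^sub>R g x)"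
    using similarity_affine[OF assms] .
  have q: "q > 0" using assms similarity_pos by blast
  have "\<exists>x. y = f x" for y
  proof -
    obtain x where "g x = (1 / q) *\<^sub>R (y - f 0)"
      using orthogonal_transformation_surj[OF g] by (metis surjD)
    then have "f x = y" using q by (subst f) simp
    then show ?thesis by blast
  qed
  then show ?thesis by (simp add: surj_def)
qed

lemma similarity_inv:
  fixes f :: "real ^ 'd \<Rightarrow> real ^ 'd"
  assumes "similarity q f"
  shows "similarity (1 / q) (inv f)"
proof -
  have "dist (inv f x) (inv f y) = 1 / q * dist x y" for x y
    using similarity_dist[OF assms, of "inv f x" "inv f y"] similarity_pos[OF assms]
    by (simp add: surj_f_inv_f[OF similarity_surj[OF assms]])
  then show ?thesis using similarity_pos[OF assms] by (simp add: similarity_def)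
qed

lemma
  fixes f :: "real ^ 'd \<Rightarrow> real ^ 'd"
  assumes "similarity q f"
  shows similarity_ball: "f ` ball x s = ball (f x) (q * s)"
    and similarity_cball: "f ` cball x s = cball (f x) (q * s)"
proof -
  have q: "q > 0" using assms similarity_pos by blast
  have "f z \<in> f ` B \<longleftrightarrow> z \<in> B" for z B
    using similarity_inj[OF assms] by (rule inj_image_mem_iff)
  then have "f z \<in> f ` ball x s \<longleftrightarrow> f z \<in> ball (f x) (q * s)"
    "f z \<in> f ` cball x s \<longleftrightarrow> f z \<in> cball (f x) (q * s)" for z
    using q by (simp_all add: similarity_dist[OF assms])
  then show "f ` ball x s = ball (f x) (q * s)" "f ` cball x s = cball (f x) (q * s)"
    using similarity_surj[OF assms] by (metis set_eqI surjD)+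
qed

lemma similarity_open_image:
  fixes f :: "real ^ 'd \<Rightarrow> real ^ 'd"
  assumes "similarity q f" "open U"
  shows "open (f ` U)"
proof -
  have q: "q > 0" using assms similarity_pos by blast
  show ?thesis
  unfolding open_contains_cball
  proof clarify
    fix x assume "x \<in> U"
    then obtain e where e: "e > 0" "cball x e \<subseteq> U" using assms(2) open_contains_cball by blast
    then have "cball (f x) (q * e) \<subseteq> f ` U"
      using similarity_cball[OF assms(1), of x e] by blast
    then show "\<exists>e>0. cball (f x) e \<subseteq> f ` U" using e q by (metis mult_pos_pos)
  qed
qed

lemma similarity_continuous_on: "similarity q f \<Longrightarrow> continuous_on A f"
  by (rule lipschitz_on_continuous_on[of q], rule lipschitz_onI)
    (auto simp: similarity_dist similarity_pos less_imp_le)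

lemma similarity_negligible:
  fixes f :: "real ^ 'd \<Rightarrow> real ^ 'd"
  assumes "similarity q f" "negligible Z"
  shows "negligible (f ` Z)"
proof (rule negligible_locally_Lipschitz_image[OF order_refl assms(2)])
  fix x assume "x \<in> Z"
  show "\<exists>T B. open T \<and> x \<in> T \<and> (\<forall>y\<in>Z \<inter> T. norm (f y - f x) \<le> B * norm (y - x))"
    by (intro exI[of _ UNIV] exI[of _ q])
      (simp add: dist_norm[symmetric] similarity_dist[OF assms(1)])
qed

text \<open>A similarity maps balls to balls, whose volume scales by \<open>q ^ CARD('d)\<close>. By the
Vitali covering theorem an open set is a disjoint union of countably many balls up to a null set, and
similarities preserve null sets.\<close>

lemma similarity_emeasure_open_le:
  fixes f :: "real ^ 'd \<Rightarrow> real ^ 'd"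
  assumes sim: "similarity q f" and U: "open U"
  shows "emeasure lebesgue (f ` U) \<le> ennreal (q ^ CARD('d)) * emeasure lebesgue U"
proof -
  have q: "q > 0" using sim similarity_pos by blast
  define K where "K = {(x, s). 0 < s \<and> ball x s \<subseteq> U}"
  have fine: "\<exists>i\<in>K. x \<in> ball (fst i) (snd i) \<and> snd i < e" if "x \<in> U" "0 < e" for x e
  proof -
    obtain s where s: "s > 0" "ball x s \<subseteq> U" using openE[OF U \<open>x \<in> U\<close>] .
    then have "(x, min s (e / 2)) \<in> K" using that by (auto simp: K_def)
    moreover have "x \<in> ball x (min s (e / 2))" "min s (e / 2) < e" using that s by auto
    ultimately show ?thesis by (metis fst_conv snd_conv)
  qed
  obtain C where C: "countable C" "C \<subseteq> K"
    and disj: "pairwise (\<lambda>i j. disjnt (ball (fst i) (snd i)) (ball (fst j) (snd j))) C"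
    and neg: "negligible (U - (\<Union>i\<in>C. ball (fst i) (snd i)))"
  proof (rule Vitali_covering_theorem_balls[of U K fst snd])
    show "\<exists>i. i \<in> K \<and> x \<in> ball (fst i) (snd i) \<and> snd i < e" if "x \<in> U" "0 < e" for x e
      using fine[OF that] by (simp add: Bex_def)
  qed
  define B where "B i = ball (fst i) (snd i)" for i :: "(real ^ 'd) \<times> real"
  have B: "emeasure lebesgue (f ` B i) = ennreal (q ^ CARD('d)) * emeasure lebesgue (B i)" if "i \<in> C" for i
    using C(2) that q unfolding B_def similarity_ball[OF sim] K_def
    by (auto simp: emeasure_ball power_mult_distrib ennreal_mult[symmetric] mult.left_commute)
  have mB: "f ` B i \<in> sets lebesgue" "B i \<in> sets lebesgue" for i
    unfolding B_def similarity_ball[OF sim] by auto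
  have dB: "disjoint_family_on B C"
    using disj by (auto simp: disjoint_family_on_def pairwise_def disjnt_def B_def)
  then have dfB: "disjoint_family_on (\<lambda>i. f ` B i) C"
    using similarity_inj[OF sim] unfolding disjoint_family_on_def
    by (metis image_Int image_empty)
  have "f ` U \<subseteq> (\<Union>i\<in>C. f ` B i) \<union> f ` (U - (\<Union>i\<in>C. B i))" by blast
  moreover have null: "f ` (U - (\<Union>i\<in>C. B i)) \<in> null_sets lebesgue"
    using similarity_negligible[OF sim neg] by (simp add: B_def negligible_iff_null_sets)
  moreover have UN: "(\<Union>i\<in>C. f ` B i) \<in> sets lebesgue"
    using C(1) mB by (intro sets.countable_UN'') auto
  ultimately have "emeasure lebesgue (f ` U) \<le> emeasure lebesgue ((\<Union>i\<in>C. f ` B i) \<union> f ` (U - (\<Union>i\<in>C. B i)))"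
    by (intro emeasure_mono) auto
  also have "\<dots> = emeasure lebesgue (\<Union>i\<in>C. f ` B i)"
    by (rule emeasure_Un_null_set[OF UN null])
  also have "\<dots> = (\<integral>\<^sup>+i. emeasure lebesgue (f ` B i) \<partial>count_space C)"
    by (rule emeasure_UN_countable[OF mB(1) C(1) dfB])
  also have "\<dots> = (\<integral>\<^sup>+i. ennreal (q ^ CARD('d)) * emeasure lebesgue (B i) \<partial>count_space C)"
    by (rule nn_integral_cong) (simp add: B)
  also have "\<dots> = ennreal (q ^ CARD('d)) * (\<integral>\<^sup>+i. emeasure lebesgue (B i) \<partial>count_space C)"
    by (rule nn_integral_cmult) simp
  also have "(\<integral>\<^sup>+i. emeasure lebesgue (B i) \<partial>count_space C) = emeasure lebesgue (\<Union>i\<in>C. B i)"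
    by (rule emeasure_UN_countable[OF mB(2) C(1) dB, symmetric])
  also have "\<dots> \<le> emeasure lebesgue U"
  proof (rule emeasure_mono)
    show "(\<Union>i\<in>C. B i) \<subseteq> U" using C(2) unfolding B_def K_def by fastforce
  qed (use U in auto)
  finally show ?thesis by (simp add: mult_left_mono)
qed

text \<open>The bound passes from open sets to measurable sets by outer regularity.\<close>

lemma
  fixes f :: "real ^ 'd \<Rightarrow> real ^ 'd"
  assumes sim: "similarity q f" and A: "A \<in> lmeasurable"
  shows similarity_lmeasurable: "f ` A \<in> lmeasurable"
    and similarity_measure_le: "measure lebesgue (f ` A) \<le> q ^ CARD('d) * measure lebesgue A"
proof -
  have q: "q > 0" using sim similarity_pos by blast
  have fA: "f ` A \<in> sets lebesgue"
    using A similarity_continuous_on[OF sim] similarity_negligible[OF sim]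
    by (intro sets_lebesgue_continuous_image[of A UNIV]) auto
  have approx: "emeasure lebesgue (f ` A) \<le> ennreal (q ^ CARD('d) * (measure lebesgue A + e))"
    if e: "e > 0" for e
  proof -
    obtain T where T: "open T" "A \<subseteq> T" "T - A \<in> lmeasurable" "emeasure lebesgue (T - A) < ennreal e"
      using sets_lebesgue_outer_open[OF fmeasurableD[OF A] e] .
    have "emeasure lebesgue T = emeasure lebesgue A + emeasure lebesgue (T - A)"
      using A T(2,3) plus_emeasure[of A lebesgue "T - A"] by (simp add: fmeasurableD Un_absorb1)
    also have "\<dots> \<le> emeasure lebesgue A + ennreal e"
      using T(4) by (intro add_left_mono) simp
    also have "\<dots> = ennreal (measure lebesgue A + e)"
      using A e by (simp add: emeasure_eq_measure2)
    finally have "emeasure lebesgue T \<le> ennreal (measure lebesgue A + e)" .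
    moreover have "emeasure lebesgue (f ` A) \<le> emeasure lebesgue (f ` T)"
      using T(2) similarity_open_image[OF sim T(1)] by (intro emeasure_mono) auto
    ultimately have "emeasure lebesgue (f ` A) \<le> ennreal (q ^ CARD('d)) * ennreal (measure lebesgue A + e)"
      using similarity_emeasure_open_le[OF sim T(1)] by (meson mult_left_mono order_trans zero_le)
    then show ?thesis using q e by (simp add: ennreal_mult)
  qed
  have "emeasure lebesgue (f ` A) < \<infinity>"
    using approx[of 1] by (auto intro: le_less_trans)
  with fA show fA': "f ` A \<in> lmeasurable" by (intro fmeasurableI) auto
  have "measure lebesgue (f ` A) / q ^ CARD('d) \<le> measure lebesgue A"
  proof (rule field_le_epsilon)
    fix e :: real assume "e > 0"
    then show "measure lebesgue (f ` A) / q ^ CARD('d) \<le> measure lebesgue A + e"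
      using approx[of e] fA' q by (simp add: emeasure_eq_measure2 pos_divide_le_eq mult.commute)
  qed
  then show "measure lebesgue (f ` A) \<le> q ^ CARD('d) * measure lebesgue A"
    using q by (simp add: pos_divide_le_eq mult.commute)
qed

text \<open>The reverse inequality is the same bound for the inverse similarity.\<close>

lemma similarity_measure:
  fixes f :: "real ^ 'd \<Rightarrow> real ^ 'd"
  assumes sim: "similarity q f" and A: "A \<in> lmeasurable"
  shows "measure lebesgue (f ` A) = q ^ CARD('d) * measure lebesgue A"
proof (rule antisym[OF similarity_measure_le[OF assms]])
  have q: "q > 0" using sim similarity_pos by blast
  have "measure lebesgue (inv f ` f ` A) \<le> (1 / q) ^ CARD('d) * measure lebesgue (f ` A)"
    by (rule similarity_measure_le[OF similarity_inv[OF sim] similarity_lmeasurable[OF assms]])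
  then show "q ^ CARD('d) * measure lebesgue A \<le> measure lebesgue (f ` A)"
    using q by (simp add: image_inv_f_f[OF similarity_inj[OF sim]] power_divide field_simps)
qed

section \<open>Words, cylinders and stopping at a given size\<close>

primrec word_map :: "(nat \<Rightarrow> 'a \<Rightarrow> 'a) \<Rightarrow> nat list \<Rightarrow> 'a \<Rightarrow> 'a" where
  "word_map S [] = id"
| "word_map S (i # w) = S i \<circ> word_map S w"

definition word_ratio :: "(nat \<Rightarrow> real) \<Rightarrow> nat list \<Rightarrow> real" where
  "word_ratio r w = prod_list (map r w)"

lemma word_ratio_simps [simp]:
  "word_ratio r [] = 1" "word_ratio r (i # w) = r i * word_ratio r w"
  "word_ratio r (v @ w) = word_ratio r v * word_ratio r w"
  by (simp_all add: word_ratio_def)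

lemma word_map_append [simp]: "word_map S (v @ w) = word_map S v \<circ> word_map S w"
  by (induction v) (simp_all add: o_assoc)

text \<open>Unfolding the recursion, \<open>stops_at r w t\<close> says that the ratio of
\<open>w\<close> is at most \<open>t\<close> and that the ratio of every proper prefix of
\<open>w\<close> exceeds \<open>t\<close>. These words list the cylinders of size about \<open>t\<close>:
they form an antichain, and their cylinders cover the self-similar set. Recursion on the first letter,
with \<open>t\<close> rescaled, makes the facts below plain list inductions.\<close>

primrec stops_at :: "(nat \<Rightarrow> real) \<Rightarrow> nat list \<Rightarrow> real \<Rightarrow> bool" where
  "stops_at r [] t \<longleftrightarrow> 1 \<le> t"
| "stops_at r (i # w) t \<longleftrightarrow> t < 1 \<and> stops_at r w (t / r i)"

locale similarity_system =
  fixes N :: nat and S :: "nat \<Rightarrow> real ^ 'd \<Rightarrow> real ^ 'd" and r :: "nat \<Rightarrow> real"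
    and F :: "(real ^ 'd) set"
  assumes ifs: "similarity_ifs N S r"
    and self_similar: "self_similar_set N S F"
begin

lemma N_ge_2: "N \<ge> 2"
  and ratio_pos: "i \<in> {1..N} \<Longrightarrow> 0 < r i"
  and ratio_less_1: "i \<in> {1..N} \<Longrightarrow> r i < 1"
  and similarity_S: "i \<in> {1..N} \<Longrightarrow> similarity (r i) (S i)"
  using ifs by (auto simp: similarity_ifs_def contracting_similarity_def similarity_def)

lemma F_nonempty: "F \<noteq> {}" and F_compact: "compact F" and F_eq: "(\<Union>i\<in>{1..N}. S i ` F) = F"
  using self_similar by (auto simp: self_similar_set_def ifs_image_def)

definition words :: "nat list set" where
  "words = lists {1..N}"

lemma words_simps [simp]:
  "[] \<in> words" "i # w \<in> words \<longleftrightarrow> i \<in> {1..N} \<and> w \<in> words"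
  "v @ w \<in> words \<longleftrightarrow> v \<in> words \<and> w \<in> words"
  by (auto simp: words_def)

lemma similarity_word: "w \<in> words \<Longrightarrow> similarity (word_ratio r w) (word_map S w)"
proof (induction w)
  case (Cons i w)
  then have "i \<in> {1..N}" "w \<in> words" by auto
  then show ?case using similarity_comp[OF similarity_S[of i] Cons.IH] by (simp add: o_def)
qed (simp add: similarity_id)

lemma word_ratio_pos: "w \<in> words \<Longrightarrow> 0 < word_ratio r w"
  using similarity_word similarity_pos by blast

lemma word_ratio_le_1: "w \<in> words \<Longrightarrow> word_ratio r w \<le> 1"
proof (induction w)
  case (Cons i w)
  then have "word_ratio r w \<le> 1" "0 < word_ratio r w" "r i < 1"
    using word_ratio_pos ratio_less_1 by auto
  then show ?case by (simp add: mult_le_one)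
qed simp

lemma word_ratio_less_1: "w \<in> words \<Longrightarrow> w \<noteq> [] \<Longrightarrow> word_ratio r w < 1"
proof (cases w)
  case (Cons i v)
  assume "w \<in> words"
  then have "r i * word_ratio r v \<le> r i" "r i < 1"
    using Cons ratio_pos[of i] ratio_less_1[of i] word_ratio_le_1[of v]
    by (auto simp: mult_left_le)
  then show ?thesis by (simp add: Cons)
qed simp

lemma ratio_bounds:
  obtains \<rho> \<sigma> where "0 < \<rho>" "\<sigma> < 1" "0 < \<sigma>" "\<And>i. i \<in> {1..N} \<Longrightarrow> \<rho> \<le> r i" "\<And>i. i \<in> {1..N} \<Longrightarrow> r i \<le> \<sigma>"
proof (rule that[of "Min (r ` {1..N})" "Max (r ` {1..N})"])
  have ne: "finite (r ` {1..N})" "r ` {1..N} \<noteq> {}" using N_ge_2 by auto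
  show "0 < Min (r ` {1..N})" "0 < Max (r ` {1..N})" "Max (r ` {1..N}) < 1"
    using Max_in[OF ne] Min_in[OF ne] ratio_pos ratio_less_1 by (force simp del: Max_in Min_in)+
qed (auto intro: Max_ge Min_le)

lemma S_maps_F: "i \<in> {1..N} \<Longrightarrow> x \<in> F \<Longrightarrow> S i x \<in> F"
  using F_eq by blast

lemma word_map_F: "w \<in> words \<Longrightarrow> x \<in> F \<Longrightarrow> word_map S w x \<in> F"
  by (induction w) (auto intro: S_maps_F)

lemma stops_at_ratio_le: "w \<in> words \<Longrightarrow> stops_at r w t \<Longrightarrow> word_ratio r w \<le> t"
proof (induction w arbitrary: t)
  case (Cons i w)
  then have "word_ratio r w \<le> t / r i" by simp
  then show ?case using ratio_pos[of i] Cons.prems by (simp add: field_simps)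
qed simp

text \<open>The last letter of a stopped word undershoots \<open>t\<close> at most by the factor
\<open>\<rho>\<close>. The premise \<open>\<rho> * t \<le> 1\<close> covers the empty word and is
preserved by the recursion, while \<open>t \<le> 1\<close> is not.\<close>

lemma stops_at_ratio_ge:
  assumes \<rho>: "\<rho> > 0" "\<And>i. i \<in> {1..N} \<Longrightarrow> \<rho> \<le> r i"
  shows "w \<in> words \<Longrightarrow> stops_at r w t \<Longrightarrow> \<rho> * t \<le> 1 \<Longrightarrow> \<rho> * t \<le> word_ratio r w"
proof (induction w arbitrary: t)
  case (Cons i w)
  have i: "i \<in> {1..N}" "0 < r i" "\<rho> \<le> r i" using Cons.prems ratio_pos \<rho>(2) by auto
  have "\<rho> * t \<le> r i"
  proof -
    have "\<rho> * t \<le> \<rho> * 1" using Cons.prems(2) \<rho>(1) by (intro mult_left_mono) auto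
    then show ?thesis using i by linarith
  qed
  then have "\<rho> * (t / r i) \<le> word_ratio r w"
    using i Cons.prems by (intro Cons.IH) (auto simp: field_simps)
  then show ?case using i by (simp add: field_simps)
qed simp

lemma word_map_feasible: "feasible_open_set N S U \<Longrightarrow> w \<in> words \<Longrightarrow> word_map S w ` U \<subseteq> U"
proof (induction w)
  case (Cons c u)
  then have "word_map S u ` U \<subseteq> U" "S c ` U \<subseteq> U"
    unfolding feasible_open_set_def by auto
  moreover have "word_map S (c # u) ` U = S c ` (word_map S u ` U)"
    by (simp add: image_comp)
  ultimately show ?case by blast
qed auto

text \<open>Two different words that stop at the same \<open>t\<close> cannot be prefixes of each other,
so they differ at some first letter, and there the images of \<open>U\<close> are separated.\<close>

lemma stops_at_disjoint:
  assumes U: "feasible_open_set N S U"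
  shows "v \<in> words \<Longrightarrow> w \<in> words \<Longrightarrow> stops_at r v t \<Longrightarrow> stops_at r w t \<Longrightarrow> v \<noteq> w
    \<Longrightarrow> word_map S v ` U \<inter> word_map S w ` U = {}"
proof (induction v arbitrary: w t)
  case Nil
  then show ?case by (cases w) auto
next
  case (Cons a v)
  then obtain b w' where w: "w = b # w'" by (cases w) auto
  show ?case
  proof (cases "a = b")
    case True
    then have "word_map S v ` U \<inter> word_map S w' ` U = {}"
      using Cons w by auto
    moreover have "inj (S a)" using Cons.prems similarity_S similarity_inj by auto
    ultimately show ?thesis using w True by (auto simp: inj_eq)
  next
    case False
    then have "S a ` U \<inter> S b ` U = {}"
      using U Cons.prems w unfolding feasible_open_set_def by auto
    moreover have "word_map S v ` U \<subseteq> U" "word_map S w' ` U \<subseteq> U"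
      using word_map_feasible[OF U] Cons.prems w by auto
    then have "word_map S (a # v) ` U \<subseteq> S a ` U" "word_map S w ` U \<subseteq> S b ` U"
      unfolding w word_map.simps image_comp[symmetric] by (auto intro!: image_mono)
    ultimately show ?thesis by blast
  qed
qed

lemma stops_at_append:
  "j \<in> words \<Longrightarrow> w \<in> words \<Longrightarrow> stops_at r w t \<Longrightarrow> t \<le> 1 \<Longrightarrow> stops_at r (j @ w) (word_ratio r j * t)"
proof (induction j)
  case (Cons i j)
  then have i: "0 < r i" "r i < 1" using ratio_pos ratio_less_1 by auto
  have "word_ratio r j * t \<le> 1"
  proof -
    have j: "word_ratio r j \<le> 1" "0 < word_ratio r j"
      using Cons.prems word_ratio_le_1 word_ratio_pos by auto
    then have "word_ratio r j * t \<le> word_ratio r j * 1"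
      using Cons.prems by (intro mult_left_mono) auto
    then show ?thesis using j by linarith
  qed
  then have "r i * (word_ratio r j * t) \<le> r i" using i by (metis mult_left_le less_imp_le)
  then have "r i * (word_ratio r j * t) < 1" using i by linarith
  then show ?case using Cons i by (simp add: mult.assoc)
qed simp

text \<open>Follow the address of \<open>x\<close> letter by letter until the ratio drops to
\<open>t\<close>. The induction is on a number \<open>n\<close> of letters that is certainly
enough.\<close>

lemma F_in_stopped_cylinder:
  assumes "0 < t"
  shows "x \<in> F \<Longrightarrow> \<exists>w\<in>words. stops_at r w t \<and> x \<in> word_map S w ` F"
proof -
  obtain \<rho> \<sigma> where \<sigma>: "0 < \<sigma>" "\<sigma> < 1" "\<And>i. i \<in> {1..N} \<Longrightarrow> r i \<le> \<sigma>"
    using ratio_bounds by metis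
  have "\<exists>w\<in>words. stops_at r w t \<and> x \<in> word_map S w ` F" if "\<sigma> ^ n \<le> t" "x \<in> F" for n x t
    using that
  proof (induction n arbitrary: x t)
    case 0
    then show ?case by (intro bexI[of _ "[]"]) auto
  next
    case (Suc n)
    show ?case
    proof (cases "t < 1")
      case True
      obtain i y where i: "i \<in> {1..N}" and y: "y \<in> F" "x = S i y"
        using Suc.prems(2) F_eq by blast
      have "\<sigma> ^ n \<le> t / r i"
      proof -
        have "r i * \<sigma> ^ n \<le> \<sigma> * \<sigma> ^ n"
          using \<sigma>(1) \<sigma>(3)[OF i] by (intro mult_right_mono) auto
        then show ?thesis
          using Suc.prems(1) ratio_pos[OF i] by (simp add: pos_le_divide_eq mult.commute[of _ "r i"])
      qed
      then obtain w where "w \<in> words" "stops_at r w (t / r i)" "y \<in> word_map S w ` F"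
        using Suc.IH y(1) by blast
      then show ?thesis using True i y by (intro bexI[of _ "i # w"]) auto
    qed (use Suc in \<open>auto intro!: bexI[of _ "[]"]\<close>)
  qed
  moreover obtain n where "\<sigma> ^ n \<le> t"
    using real_arch_pow_inv[OF \<open>0 < t\<close> \<sigma>(2)] less_imp_le by blast
  ultimately show "x \<in> F \<Longrightarrow> ?thesis" by blast
qed

section \<open>Neighbours of a cylinder\<close>

text \<open>The words whose cylinders have about the same size as the cylinder of \<open>k\<close> and
come closer to it than that size.\<close>

definition neighbours :: "nat list \<Rightarrow> nat list set" where
  "neighbours k = {w \<in> words. stops_at r w (word_ratio r k) \<and>
     (\<exists>x\<in>F. \<exists>y\<in>F. dist (word_map S w x) (word_map S k y) < word_ratio r k)}"

text \<open>A packing argument. The images of the feasible open set \<open>U\<close> under the neighbours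
of \<open>k\<close> are disjoint, each has volume at least a fixed multiple of the \<open>d\<close>-th
power of the ratio of \<open>k\<close>, and all lie in one ball whose volume is a fixed multiple of that
power.\<close>

lemma card_neighbours_bounded:
  assumes "open_set_condition N S"
  obtains B where "\<And>k. k \<in> words \<Longrightarrow> finite (neighbours k) \<and> card (neighbours k) \<le> B"
proof -
  obtain U where U: "feasible_open_set N S U" using assms open_set_condition_def by blast
  then have U': "open U" "U \<noteq> {}" "bounded U" by (auto simp: feasible_open_set_def)
  have Um: "U \<in> lmeasurable" using U' lmeasurable_open by blast
  have Upos: "0 < measure lebesgue U"
    using U' open_not_negligible Um by (metis negligible_iff_measure0 zero_less_measure_iff)
  obtain \<rho> where \<rho>: "0 < \<rho>" "\<And>i. i \<in> {1..N} \<Longrightarrow> \<rho> \<le> r i"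
    using ratio_bounds by metis
  have \<rho>1: "\<rho> < 1" using \<rho>(2)[of 1] ratio_less_1[of 1] N_ge_2 by auto
  obtain y0 where y0: "y0 \<in> F" using F_nonempty by blast
  have "bounded (F \<union> U)" using compact_imp_bounded[OF F_compact] U' by simp
  then obtain R where R: "\<And>x y. x \<in> F \<union> U \<Longrightarrow> y \<in> F \<union> U \<Longrightarrow> dist x y \<le> R"
    by (metis bounded_two_points)
  let ?C = "cball y0 (2 * R + 1)"
  let ?\<mu> = "measure lebesgue"
  let ?d = "CARD('d)"
  let ?B = "?\<mu> ?C / (\<rho> ^ ?d * ?\<mu> U)"
  \<comment> \<open>\<open>U\<close> and \<open>F\<close> have diameter at most \<open>R\<close>
    jointly, which explains the radius \<open>2 * R + 1\<close> of the ball \<open>?C\<close>: one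
    \<open>R\<close> for each of the two cylinders and \<open>1\<close> for the gap between
    them.\<close>
  have bound: "real (card J) \<le> ?B" if k: "k \<in> words" and J: "finite J" "J \<subseteq> neighbours k" for k J
  proof -
    let ?t = "word_ratio r k"
    have t: "0 < ?t" "?t \<le> 1" using k word_ratio_pos word_ratio_le_1 by auto
    have Jw: "w \<in> words" "stops_at r w ?t" if "w \<in> J" for w
      using that J by (auto simp: neighbours_def)
    have sub: "word_map S w ` U \<subseteq> word_map S k ` ?C" if w: "w \<in> J" for w
    proof clarify
      fix z assume z: "z \<in> U"
      obtain x y where xy: "x \<in> F" "y \<in> F" "dist (word_map S w x) (word_map S k y) < ?t"
        using w J by (auto simp: neighbours_def)
      have "dist (word_map S w z) (word_map S w x) \<le> ?t * R"
        unfolding similarity_dist[OF similarity_word[OF Jw(1)[OF w]]]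
        using stops_at_ratio_le[OF Jw[OF w]] R[of z x] z xy t by (intro mult_mono) auto
      moreover have "dist (word_map S k y) (word_map S k y0) \<le> ?t * R"
        unfolding similarity_dist[OF similarity_word[OF k]] using R[of y y0] xy y0 t by simp
      ultimately have "dist (word_map S w z) (word_map S k y0) \<le> ?t * (2 * R + 1)"
        using xy(3) dist_triangle[of "word_map S w z" "word_map S k y0" "word_map S w x"]
          dist_triangle[of "word_map S w x" "word_map S k y0" "word_map S k y"]
        by (simp add: algebra_simps)
      then show "word_map S w z \<in> word_map S k ` ?C"
        by (simp add: similarity_cball[OF similarity_word[OF k]] dist_commute)
    qed
    have vol: "\<rho> ^ ?d * ?t ^ ?d * ?\<mu> U \<le> ?\<mu> (word_map S w ` U)" if w: "w \<in> J" for w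
    proof -
      have "\<rho> * ?t \<le> 1" using \<rho> \<rho>1 t by (intro mult_le_one) auto
      then have "\<rho> * ?t \<le> word_ratio r w"
        using stops_at_ratio_ge[OF \<rho> Jw[OF w]] by blast
      then have "(\<rho> * ?t) ^ ?d \<le> word_ratio r w ^ ?d" using \<rho> t by (intro power_mono) auto
      then show ?thesis
        using Upos
        by (simp add: similarity_measure[OF similarity_word[OF Jw(1)[OF w]] Um] power_mult_distrib)
    qed
    have m: "word_map S w ` U \<in> lmeasurable" if w: "w \<in> J" for w
      using similarity_lmeasurable[OF similarity_word[OF Jw(1)[OF w]] Um] by blast
    have "real (card J) * (\<rho> ^ ?d * ?t ^ ?d * ?\<mu> U) \<le> (\<Sum>w\<in>J. ?\<mu> (word_map S w ` U))"
      using sum_bounded_below[OF vol, of J] by simp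
    also have "\<dots> = ?\<mu> (\<Union>w\<in>J. word_map S w ` U)"
      using J m stops_at_disjoint[OF U Jw(1) Jw(1) Jw(2) Jw(2)]
      by (intro measure_UNION'[symmetric]) (simp_all add: pairwise_def disjnt_def)
    also have "\<dots> \<le> ?\<mu> (word_map S k ` ?C)"
      using sub m J by (intro measure_mono_fmeasurable)
        (auto intro!: fmeasurable.finite_UN similarity_lmeasurable[OF similarity_word[OF k]]
          simp: fmeasurableD)
    also have "\<dots> = ?t ^ ?d * ?\<mu> ?C"
      by (rule similarity_measure[OF similarity_word[OF k]]) simp
    finally have "?t ^ ?d * (real (card J) * (\<rho> ^ ?d * ?\<mu> U)) \<le> ?t ^ ?d * ?\<mu> ?C"
      by (simp add: ac_simps)
    then have "real (card J) * (\<rho> ^ ?d * ?\<mu> U) \<le> ?\<mu> ?C"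
      using t by simp
    then show ?thesis using Upos \<rho> by (simp add: pos_le_divide_eq)
  qed
  have "finite (neighbours k) \<and> card (neighbours k) \<le> nat \<lfloor>?B\<rfloor>" if k: "k \<in> words" for k
  proof -
    have *: "card J \<le> nat \<lfloor>?B\<rfloor>" if "finite J" "J \<subseteq> neighbours k" for J
      using bound[OF k that] by linarith
    have "finite (neighbours k)"
    proof (rule ccontr)
      assume "infinite (neighbours k)"
      then obtain J where "finite J" "card J = Suc (nat \<lfloor>?B\<rfloor>)" "J \<subseteq> neighbours k"
        using infinite_arbitrarily_large by blast
      then show False using *[of J] by simp
    qed
    then show ?thesis using * by blast
  qed
  then show thesis using that by blast
qed

text \<open>Schief's maximality argument. Let \<open>k\<close> have the largest number of neighbours.
Prefixing a word \<open>a # j\<close> sends neighbours of \<open>k\<close> injectively to neighbours of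
\<open>(a # j) @ k\<close>, hence by maximality onto them. So the word of every cylinder that has the
size of the cylinder of \<open>(a # j) @ k\<close> and is close to it starts with \<open>a # j\<close>;
in particular no point of a first-level piece other than the \<open>a\<close>-th one is close to
it.\<close>

lemma separated_cylinder:
  assumes "open_set_condition N S"
  obtains k where "k \<in> words"
    and "\<And>a j b x y. a # j \<in> words \<Longrightarrow> b \<in> {1..N} \<Longrightarrow> a \<noteq> b \<Longrightarrow> x \<in> F \<Longrightarrow> y \<in> F \<Longrightarrow>
      word_ratio r (a # j) * word_ratio r k \<le> dist (word_map S (a # j) (word_map S k x)) (S b y)"
proof -
  obtain B where B: "\<And>k. k \<in> words \<Longrightarrow> finite (neighbours k) \<and> card (neighbours k) \<le> B"
    using card_neighbours_bounded[OF assms] by blast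
  obtain k where k: "k \<in> words" and max: "\<And>l. l \<in> words \<Longrightarrow> card (neighbours l) \<le> card (neighbours k)"
    using ex_has_greatest_nat[of "\<lambda>k. k \<in> words" "[]" "\<lambda>k. card (neighbours k)" "Suc B"] B
    by (auto simp: less_Suc_eq_le)
  show thesis
  proof (rule that[OF k])
    fix a j b x y
    assume aj: "a # j \<in> words" and b: "b \<in> {1..N}" "a \<noteq> b" and xy: "x \<in> F" "y \<in> F"
    let ?j = "a # j"
    have sim: "similarity (word_ratio r ?j) (word_map S ?j)" by (rule similarity_word[OF aj])
    let ?t = "word_ratio r (?j @ k)"
    have "(@) ?j ` neighbours k \<subseteq> neighbours (?j @ k)"
    proof
      fix u assume "u \<in> (@) ?j ` neighbours k"
      then obtain w where w: "w \<in> neighbours k" and u: "u = ?j @ w" by blast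
      then obtain x y where "x \<in> F" "y \<in> F"
        and xy: "dist (word_map S w x) (word_map S k y) < word_ratio r k"
        by (auto simp: neighbours_def)
      moreover have "dist (word_map S (?j @ w) x) (word_map S (?j @ k) y) < ?t"
        using xy similarity_pos[OF sim] unfolding word_map_append o_apply word_ratio_simps(3)
        by (simp only: similarity_dist[OF sim] mult_less_cancel_left_pos)
      moreover have "stops_at r (?j @ w) ?t" "?j @ w \<in> words"
        using w aj word_ratio_le_1[OF k] stops_at_append[OF aj] unfolding word_ratio_simps(3)
        by (auto simp: neighbours_def simp del: word_ratio_simps append_Cons)
      ultimately show "u \<in> neighbours (?j @ k)" unfolding u neighbours_def by blast
    qed
    moreover have "card ((@) ?j ` neighbours k) = card (neighbours k)"
      by (intro card_image inj_onI) simp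
    moreover have "card (neighbours (?j @ k)) \<le> card (neighbours k)" "finite (neighbours (?j @ k))"
      using max[of "?j @ k"] B[of "?j @ k"] aj k by auto
    ultimately have eq: "neighbours (?j @ k) = (@) ?j ` neighbours k"
      by (metis card_seteq)
    \<comment> \<open>If a point of another first-level piece were too close, its stopped cylinder
      would be a neighbour whose first letter is \<open>b\<close>.\<close>
    show "word_ratio r ?j * word_ratio r k \<le> dist (word_map S ?j (word_map S k x)) (S b y)"
    proof (rule ccontr)
      assume "\<not> ?thesis"
      then have less: "dist (S b y) (word_map S (?j @ k) x) < ?t"
        by (simp add: dist_commute mult.assoc)
      have t: "0 < ?t" "?t < 1"
        using aj k word_ratio_pos[of "?j @ k"] word_ratio_less_1[of "?j @ k"] by auto
      obtain w where w: "w \<in> words" "stops_at r w (?t / r b)" "y \<in> word_map S w ` F"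
        using F_in_stopped_cylinder[of "?t / r b" y] xy(2) t ratio_pos[OF b(1)] by auto
      then obtain z where "z \<in> F" "y = word_map S w z" by blast
      then have "b # w \<in> neighbours (?j @ k)"
        using w b t less xy unfolding neighbours_def by auto
      then show False using eq b by auto
    qed
  qed
qed

section \<open>The central open set\<close>

lemma infdist_F_le_cylinder: "w \<in> words \<Longrightarrow> infdist x F \<le> infdist x (word_map S w ` F)"
  using word_map_F F_nonempty by (intro infdist_mono) auto

text \<open>Let \<open>H\<close> be the union of the neighbour sets, the preimages of the pieces \<open>S
b ` F\<close> under the word maps of \<open>a # j\<close> with \<open>a \<noteq> b\<close>. The central
open set of Bandt, Hung and Rao consists of the points strictly closer to \<open>F\<close> than to
\<open>H\<close>. The definition avoids inverse maps by comparing distances after applying the word map,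
which multiplies them by the word ratio; the number \<open>e\<close> keeps the inequality strict in the
infimum over the infinitely many neighbour sets.\<close>

definition central_set :: "(real ^ 'd) set" where
  "central_set = {x. \<exists>e>0. \<forall>a j b. a # j \<in> words \<longrightarrow> b \<in> {1..N} \<longrightarrow> a \<noteq> b \<longrightarrow>
     word_ratio r (a # j) * (infdist x F + e) \<le> infdist (word_map S (a # j) x) (S b ` F)}"

lemma open_central_set: "open central_set"
  unfolding open_dist
proof
  fix x assume "x \<in> central_set"
  then obtain e where e: "e > 0" and x: "\<And>a j b. a # j \<in> words \<Longrightarrow> b \<in> {1..N} \<Longrightarrow> a \<noteq> b \<Longrightarrow>
     word_ratio r (a # j) * (infdist x F + e) \<le> infdist (word_map S (a # j) x) (S b ` F)"
    unfolding central_set_def by blast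
  have "y \<in> central_set" if y: "dist y x < e / 3" for y
    unfolding central_set_def
  proof (intro CollectI exI conjI allI impI)
    \<comment> \<open>Moving \<open>x\<close> by \<open>dist y x\<close> costs this distance once on
      each side of the inequality; one third of \<open>e\<close> is left.\<close>
    show "e / 3 > 0" using e by simp
    fix a j b assume aj: "a # j \<in> words" and b: "b \<in> {1..N}" "a \<noteq> b"
    let ?q = "word_ratio r (a # j)" and ?f = "word_map S (a # j)"
    have sim: "similarity ?q ?f" by (rule similarity_word[OF aj])
    have "infdist y F + e / 3 \<le> infdist x F + e - dist y x"
      using infdist_triangle[of y F x] y by linarith
    then have "?q * (infdist y F + e / 3) \<le> ?q * (infdist x F + e - dist y x)"
      using similarity_pos[OF sim] by (intro mult_left_mono) auto
    also have "\<dots> = ?q * (infdist x F + e) - dist (?f x) (?f y)"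
      unfolding similarity_dist[OF sim] by (simp only: right_diff_distrib dist_commute)
    also have "\<dots> \<le> infdist (?f x) (S b ` F) - dist (?f x) (?f y)"
      using x[OF aj b] by linarith
    also have "\<dots> \<le> infdist (?f y) (S b ` F)"
      using infdist_triangle[of "?f x" "S b ` F" "?f y"] by linarith
    finally show "?q * (infdist y F + e / 3) \<le> infdist (?f y) (S b ` F)" .
  qed
  then show "\<exists>e>0. \<forall>y. dist y x < e \<longrightarrow> y \<in> central_set"
    using e by (intro exI[of _ "e / 3"]) auto
qed

text \<open>Applying \<open>S i\<close> scales distances, and the condition for \<open>S i x\<close> at
the word \<open>a # j\<close> is implied by the one for \<open>x\<close> at the word \<open>a # (j @
[i])\<close>.\<close>

lemma S_maps_central_set:
  assumes i: "i \<in> {1..N}" and x: "x \<in> central_set"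
  shows "S i x \<in> central_set"
proof -
  obtain e where e: "e > 0" and x: "\<And>a j b. a # j \<in> words \<Longrightarrow> b \<in> {1..N} \<Longrightarrow> a \<noteq> b \<Longrightarrow>
     word_ratio r (a # j) * (infdist x F + e) \<le> infdist (word_map S (a # j) x) (S b ` F)"
    using x unfolding central_set_def by blast
  have ri: "r i > 0" using i ratio_pos by blast
  have Si: "infdist (S i x) F \<le> r i * infdist x F"
    using infdist_F_le_cylinder[of "[i]" "S i x"] i similarity_infdist[OF similarity_S[OF i], of x F] by simp
  show ?thesis unfolding central_set_def
  proof (intro CollectI exI conjI allI impI)
    show "r i * e > 0" using ri e by simp
    fix a j b assume aj: "a # j \<in> words" and b: "b \<in> {1..N}" "a \<noteq> b"
    have "word_ratio r (a # j) * (infdist (S i x) F + r i * e)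
        \<le> word_ratio r (a # j) * (r i * (infdist x F + e))"
      using Si word_ratio_pos[OF aj] by (intro mult_left_mono) (auto simp: algebra_simps)
    also have "\<dots> = word_ratio r (a # (j @ [i])) * (infdist x F + e)" by simp
    also have "\<dots> \<le> infdist (word_map S (a # (j @ [i])) x) (S b ` F)"
      using aj b i by (intro x) auto
    finally show "word_ratio r (a # j) * (infdist (S i x) F + r i * e)
      \<le> infdist (word_map S (a # j) (S i x)) (S b ` F)" by simp
  qed
qed

text \<open>This is the defining condition at the one-letter word \<open>[i]\<close>. It yields both the
disjointness of the images of the central set under different maps and the projection property.\<close>

lemma central_set_nearest:
  assumes i: "i \<in> {1..N}" and j: "j \<in> {1..N}" "i \<noteq> j" and x: "x \<in> central_set"
  shows "infdist (S i x) (S i ` F) < infdist (S i x) (S j ` F)"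
proof -
  obtain e where e: "e > 0" and "r i * (infdist x F + e) \<le> infdist (S i x) (S j ` F)"
  proof -
    have "\<exists>e>0. word_ratio r [i] * (infdist x F + e) \<le> infdist (word_map S [i] x) (S j ` F)"
      using x i j words_simps unfolding central_set_def by blast
    then show thesis using that by auto
  qed
  moreover have "infdist (S i x) (S i ` F) = r i * infdist x F"
    by (rule similarity_infdist[OF similarity_S[OF i]])
  moreover have "r i * infdist x F < r i * (infdist x F + e)"
    using ratio_pos[OF i] e by (intro mult_strict_left_mono) auto
  ultimately show ?thesis by linarith
qed

lemma cylinder_subset_central_set:
  assumes "open_set_condition N S"
  obtains k where "k \<in> words" "word_map S k ` F \<subseteq> central_set"
proof -
  obtain k where k: "k \<in> words" and sep: "\<And>a j b x y. a # j \<in> words \<Longrightarrow> b \<in> {1..N} \<Longrightarrow> a \<noteq> b \<Longrightarrow> x \<in> F \<Longrightarrow> y \<in> F \<Longrightarrow>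
      word_ratio r (a # j) * word_ratio r k \<le> dist (word_map S (a # j) (word_map S k x)) (S b y)"
    using separated_cylinder[OF assms] by blast
  have "word_map S k x \<in> central_set" if x: "x \<in> F" for x
    unfolding central_set_def
  proof (intro CollectI exI conjI allI impI)
    show "word_ratio r k > 0" by (rule word_ratio_pos[OF k])
    fix a j b assume aj: "a # j \<in> words" and b: "b \<in> {1..N}" "a \<noteq> b"
    have ne: "S b ` F \<noteq> {}" using F_nonempty by simp
    have "infdist (word_map S k x) F = 0" using word_map_F[OF k x] by simp
    then show "word_ratio r (a # j) * (infdist (word_map S k x) F + word_ratio r k)
      \<le> infdist (word_map S (a # j) (word_map S k x)) (S b ` F)"
      unfolding infdist_notempty[OF ne] using ne sep[OF aj b x]
      by (intro cINF_greatest) auto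
  qed
  then show thesis using that k by blast
qed

text \<open>The central set can be unbounded, for instance if \<open>F\<close> lies in a hyperplane. A
large ball cuts it down to a bounded set without destroying invariance.\<close>

lemma ball_mapped_into_itself:
  obtains R where "F \<subseteq> ball 0 R" "\<And>i. i \<in> {1..N} \<Longrightarrow> S i ` ball 0 R \<subseteq> ball 0 R"
proof -
  obtain \<rho> \<sigma> where \<sigma>: "0 < \<sigma>" "\<sigma> < 1" "\<And>i. i \<in> {1..N} \<Longrightarrow> r i \<le> \<sigma>"
    using ratio_bounds by metis
  obtain R0 where R0: "\<And>x. x \<in> F \<Longrightarrow> norm x < R0"
    using compact_imp_bounded[OF F_compact] by (auto simp: bounded_pos_less)
  have "bounded ((\<lambda>i. S i 0) ` {1..N})" by (intro finite_imp_bounded) simp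
  then obtain T where T: "\<And>i. i \<in> {1..N} \<Longrightarrow> norm (S i 0) < T"
    by (auto simp: bounded_pos_less simp del: atLeastAtMost_iff)
  define R where "R = max R0 (T / (1 - \<sigma>))"
  have T_le: "T \<le> (1 - \<sigma>) * R"
  proof -
    have "T / (1 - \<sigma>) \<le> R" by (simp add: R_def)
    then show ?thesis using \<sigma> by (simp add: pos_divide_le_eq mult.commute)
  qed
  have "S i x \<in> ball 0 R" if i: "i \<in> {1..N}" and x: "x \<in> ball 0 R" for i x
  proof -
    have "norm (S i x) \<le> dist (S i x) (S i 0) + norm (S i 0)"
      using norm_triangle_sub[of "S i x" "S i 0"] by (simp add: dist_norm)
    also have "dist (S i x) (S i 0) = r i * norm x" by (simp add: similarity_dist[OF similarity_S[OF i]])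
    also have "\<dots> \<le> \<sigma> * R" using \<sigma> i x ratio_pos[OF i] by (intro mult_mono) auto
    finally show ?thesis using T[OF i] T_le by (simp add: algebra_simps)
  qed
  moreover have "F \<subseteq> ball 0 R" using R0 by (force simp: R_def)
  ultimately show thesis using that by blast
qed

text \<open>Besides feasibility, two properties matter for the volume of parallel sets: a whole cylinder
of \<open>F\<close> lies inside \<open>U\<close>, and a point of \<open>S i ` U\<close> sees its nearest
points of \<open>F\<close> in the piece \<open>S i ` F\<close>.\<close>

theorem strong_open_set_with_projection:
  assumes "open_set_condition N S"
  obtains U k where "feasible_open_set N S U" "k \<in> words" "word_map S k ` F \<subseteq> U"
    "\<And>i z. i \<in> {1..N} \<Longrightarrow> z \<in> S i ` U \<Longrightarrow> infdist z F = infdist z (S i ` F)"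
proof -
  obtain k where k: "k \<in> words" "word_map S k ` F \<subseteq> central_set"
    using cylinder_subset_central_set[OF assms] .
  obtain R where R: "F \<subseteq> ball 0 R" "\<And>i. i \<in> {1..N} \<Longrightarrow> S i ` ball 0 R \<subseteq> ball 0 R"
    using ball_mapped_into_itself by blast
  let ?U = "central_set \<inter> ball 0 R"
  have kU: "word_map S k ` F \<subseteq> ?U" using k R(1) word_map_F by blast
  have disj: "S i ` ?U \<inter> S j ` ?U = {}" if ij: "i \<in> {1..N}" "j \<in> {1..N}" "i \<noteq> j" for i j
  proof (rule ccontr)
    assume "\<not> ?thesis"
    then obtain x y where xy: "x \<in> central_set" "y \<in> central_set" "S i x = S j y" by blast
    show False
      using central_set_nearest[OF ij xy(1)] central_set_nearest[OF ij(2,1) ij(3)[symmetric] xy(2)] xy(3)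
      by simp
  qed
  have sub: "S i ` ?U \<subseteq> ?U" if i: "i \<in> {1..N}" for i
    using R(2)[OF i] S_maps_central_set[OF i] by blast
  have "feasible_open_set N S ?U"
    unfolding feasible_open_set_def
  proof (intro conjI ballI impI)
    show "open ?U" using open_central_set by (rule open_Int) simp
    show "?U \<noteq> {}" using kU F_nonempty by blast
  qed (use sub disj in auto)
  moreover have "infdist z F = infdist z (S i ` F)" if i: "i \<in> {1..N}" and z: "z \<in> S i ` ?U" for i z
  proof (rule antisym)
    show "infdist z F \<le> infdist z (S i ` F)" using infdist_F_le_cylinder[of "[i]" z] i by simp
    have "infdist z (S i ` F) \<le> dist z y" if y: "y \<in> F" for y
    proof -
      obtain j where j: "j \<in> {1..N}" "y \<in> S j ` F" using y F_eq by blast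
      have "infdist z (S i ` F) \<le> infdist z (S j ` F)"
        using central_set_nearest[OF i j(1)] z by (cases "i = j") (auto intro: less_imp_le)
      also have "\<dots> \<le> dist z y" by (rule infdist_le[OF j(2)])
      finally show ?thesis .
    qed
    then show "infdist z (S i ` F) \<le> infdist z F"
      unfolding infdist_notempty[OF F_nonempty] using F_nonempty by (intro cINF_greatest) auto
  qed
  ultimately show thesis using that k(1) kU by blast
qed

end

section \<open>Volumes of parallel sets\<close>

context similarity_system
begin

lemma parallel_set_lmeasurable: "parallel_set F \<epsilon> \<in> lmeasurable"
proof -
  have "closed (parallel_set F \<epsilon>)"
    unfolding parallel_set_def by (intro closed_Collect_le continuous_intros)
  moreover have "parallel_set F \<epsilon> \<subseteq> {x. infdist x F \<le> max \<epsilon> 1}"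
    by (auto simp: parallel_set_def)
  then have "bounded (parallel_set F \<epsilon>)"
    using bounded_subset compact_imp_bounded[OF compact_infdist_le[OF F_nonempty F_compact]]
    by (metis max.strict_coboundedI2 zero_less_one)
  ultimately show ?thesis by (intro lmeasurable_compact) (simp add: compact_eq_bounded_closed)
qed

definition parallel_volume :: "(real ^ 'd) set \<Rightarrow> real \<Rightarrow> real" where
  "parallel_volume Q \<epsilon> = measure lebesgue (parallel_set F \<epsilon> \<inter> Q)"

lemma parallel_set_Int_lmeasurable: "Q \<in> sets lebesgue \<Longrightarrow> parallel_set F \<epsilon> \<inter> Q \<in> lmeasurable"
  by (rule fmeasurable_Int_fmeasurable[OF parallel_set_lmeasurable])

lemma volume_nonneg: "0 \<le> parallel_volume Q \<epsilon>"
  by (simp add: parallel_volume_def)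

lemma volume_mono: "Q \<in> sets lebesgue \<Longrightarrow> mono (parallel_volume Q)"
  unfolding parallel_volume_def
  by (intro monoI measure_mono_fmeasurable parallel_set_Int_lmeasurable)
    (auto simp: parallel_set_def intro: fmeasurableD parallel_set_Int_lmeasurable[unfolded parallel_set_def])

lemma volume_Un:
  "Q \<in> sets lebesgue \<Longrightarrow> Q' \<in> sets lebesgue \<Longrightarrow> Q \<inter> Q' = {} \<Longrightarrow> parallel_volume (Q \<union> Q') \<epsilon> = parallel_volume Q \<epsilon> + parallel_volume Q' \<epsilon>"
  unfolding parallel_volume_def Int_Un_distrib
  by (rule measure_Union)
    (auto intro!: fmeasurableD parallel_set_Int_lmeasurable fmeasurableD2[OF parallel_set_Int_lmeasurable])

lemma parallel_set_cylinder_cover: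
  assumes W: "W \<subseteq> words" and cover: "F \<subseteq> (\<Union>w\<in>W. word_map S w ` F)" and z: "z \<in> parallel_set F \<epsilon>"
  obtains w y where "w \<in> W" "z = word_map S w y" "y \<in> parallel_set F (\<epsilon> / word_ratio r w)"
proof -
  obtain a where a: "a \<in> F" "dist z a = infdist z F"
    using infdist_attains_inf[OF compact_imp_closed[OF F_compact] F_nonempty] by metis
  obtain w where w: "w \<in> W" "a \<in> word_map S w ` F" using cover a by blast
  have sim: "similarity (word_ratio r w) (word_map S w)" using similarity_word w W by blast
  obtain y where y: "z = word_map S w y" using similarity_surj[OF sim] by (metis surjD)
  have "word_ratio r w * infdist y F \<le> \<epsilon>"
    using infdist_le[OF w(2), of z] a z y by (simp add: similarity_infdist[OF sim] parallel_set_def)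
  then have "y \<in> parallel_set F (\<epsilon> / word_ratio r w)"
    using similarity_pos[OF sim] by (simp add: parallel_set_def field_simps)
  then show thesis using that w y by blast
qed

text \<open>A point within \<open>\<epsilon>\<close> of \<open>F\<close> is within
\<open>\<epsilon>\<close> of one of the cylinders covering \<open>F\<close>, so it can be pulled back by
the corresponding word map. The premise \<open>pull\<close> says which words can occur for points of
\<open>Q\<close> and where the pulled-back points lie.\<close>

lemma volume_cover:
  assumes W: "finite W" "W \<subseteq> words" "F \<subseteq> (\<Union>w\<in>W. word_map S w ` F)"
    and Q: "Q \<in> sets lebesgue" and Q': "Q' \<in> sets lebesgue"
    and W': "W' \<subseteq> W"
    and pull: "\<And>w y. w \<in> W \<Longrightarrow> word_map S w y \<in> Q \<Longrightarrow> y \<in> parallel_set F (\<epsilon> / word_ratio r w) \<Longrightarrow> w \<in> W' \<and> y \<in> Q'"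
  shows "parallel_volume Q \<epsilon> \<le> (\<Sum>w\<in>W'. word_ratio r w ^ CARD('d) * parallel_volume Q' (\<epsilon> / word_ratio r w))"
proof -
  let ?B = "\<lambda>w. word_map S w ` (parallel_set F (\<epsilon> / word_ratio r w) \<inter> Q')"
  have fin: "finite W'" and sim: "w \<in> W' \<Longrightarrow> similarity (word_ratio r w) (word_map S w)" for w
    using W W' finite_subset similarity_word by blast+
  have B: "?B w \<in> lmeasurable" if "w \<in> W'" for w
    by (intro similarity_lmeasurable[OF sim[OF that]] parallel_set_Int_lmeasurable Q')
  have "parallel_set F \<epsilon> \<inter> Q \<subseteq> (\<Union>w\<in>W'. ?B w)"
  proof
    fix z assume z: "z \<in> parallel_set F \<epsilon> \<inter> Q"
    then obtain w y where "w \<in> W" "z = word_map S w y" "y \<in> parallel_set F (\<epsilon> / word_ratio r w)"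
      using parallel_set_cylinder_cover[OF W(2,3)] by blast
    then show "z \<in> (\<Union>w\<in>W'. ?B w)" using pull z by blast
  qed
  then have "parallel_volume Q \<epsilon> \<le> measure lebesgue (\<Union>w\<in>W'. ?B w)"
    unfolding parallel_volume_def using B fin parallel_set_Int_lmeasurable[OF Q]
    by (intro measure_mono_fmeasurable) (auto intro: fmeasurableD)
  also have "\<dots> \<le> (\<Sum>w\<in>W'. measure lebesgue (?B w))"
    by (rule measure_UNION_le[OF fin]) (use B fmeasurableD in blast)
  also have "\<dots> = (\<Sum>w\<in>W'. word_ratio r w ^ CARD('d) * parallel_volume Q' (\<epsilon> / word_ratio r w))"
    by (intro sum.cong refl)
      (simp add: parallel_volume_def similarity_measure[OF sim] parallel_set_Int_lmeasurable Q')
  finally show ?thesis .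
qed

definition words_of_length :: "nat \<Rightarrow> nat list set" where
  "words_of_length n = {w. set w \<subseteq> {1..N} \<and> length w = n}"

lemma finite_words_of_length: "finite (words_of_length n)"
  unfolding words_of_length_def by (rule finite_lists_length_eq) simp

lemma words_of_length_subset: "words_of_length n \<subseteq> words"
  by (auto simp: words_of_length_def words_def)

lemma words_of_length_Suc: "words_of_length (Suc n) = (\<lambda>(i, w). i # w) ` ({1..N} \<times> words_of_length n)"
  by (auto simp: words_of_length_def image_iff length_Suc_conv)

text \<open>Expanding the \<open>n\<close>-th power of Moran's equation.\<close>

lemma sum_words_of_length:
  assumes "similarity_dimension N r D"
  shows "(\<Sum>w\<in>words_of_length n. word_ratio r w powr D) = 1"
proof (induction n)
  case 0
  have "words_of_length 0 = {[]}" by (auto simp: words_of_length_def)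
  then show ?case by simp
next
  case (Suc n)
  have "(\<Sum>w\<in>words_of_length (Suc n). word_ratio r w powr D)
     = (\<Sum>(i, w)\<in>{1..N} \<times> words_of_length n. word_ratio r (i # w) powr D)"
    unfolding words_of_length_Suc by (subst sum.reindex) (auto simp: inj_on_def case_prod_beta)
  also have "\<dots> = (\<Sum>i=1..N. \<Sum>w\<in>words_of_length n. r i powr D * word_ratio r w powr D)"
  proof -
    have "word_ratio r (i # w) powr D = r i powr D * word_ratio r w powr D"
      if "i \<in> {1..N}" "w \<in> words_of_length n" for i w
      using that ratio_pos[of i] word_ratio_pos[of w] words_of_length_subset
      by (auto simp: powr_mult less_imp_le)
    then show ?thesis by (simp add: sum.cartesian_product[symmetric])
  qed
  also have "\<dots> = (\<Sum>i=1..N. r i powr D)" by (simp add: sum_distrib_left[symmetric] Suc)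
  finally show ?case using assms by (simp add: similarity_dimension_def)
qed

lemma F_cover_words_of_length: "F \<subseteq> (\<Union>w\<in>words_of_length n. word_map S w ` F)"
proof (induction n)
  case 0
  have "[] \<in> words_of_length 0" by (simp add: words_of_length_def)
  then show ?case by force
next
  case (Suc n)
  show ?case
  proof
    fix x assume "x \<in> F"
    then obtain i y where i: "i \<in> {1..N}" "y \<in> F" "x = S i y" using F_eq by blast
    then obtain w where "w \<in> words_of_length n" "y \<in> word_map S w ` F" using Suc by blast
    then have "i # w \<in> words_of_length (Suc n)" "x \<in> word_map S (i # w) ` F"
      using i by (auto simp: words_of_length_def)
    then show "x \<in> (\<Union>w\<in>words_of_length (Suc n). word_map S w ` F)" by blast
  qed
qed

text \<open>The reason why the volume outside \<open>U\<close> is negligible: the cylinder of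
\<open>k\<close> is interior to \<open>U\<close> and contributes nothing to it for small
\<open>\<epsilon>\<close>. In this renewal inequality the weights lack the \<open>k\<close>-th term, so
that by Moran's equation the \<open>D\<close>-th powers of the ratios add up to less than
\<open>1\<close>.\<close>

lemma volume_outside_le:
  assumes U: "feasible_open_set N S U" and k: "k \<in> words" "word_map S k ` F \<subseteq> U"
  obtains \<alpha> where "\<alpha> > 0"
    and "\<And>\<epsilon>. \<epsilon> \<le> \<alpha> \<Longrightarrow> parallel_volume (- U) \<epsilon> \<le>
      (\<Sum>w\<in>words_of_length (length k) - {k}. word_ratio r w ^ CARD('d) * parallel_volume (- U) (\<epsilon> / word_ratio r w))"
proof -
  have oU: "open U" using U by (simp add: feasible_open_set_def)
  have sim: "similarity (word_ratio r k) (word_map S k)" by (rule similarity_word[OF k(1)])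
  have "compact (word_map S k ` F)"
    by (rule compact_continuous_image[OF similarity_continuous_on[OF sim] F_compact])
  then obtain \<alpha> where \<alpha>: "\<alpha> > 0" "{x. infdist x (word_map S k ` F) \<le> \<alpha>} \<subseteq> U"
    using compact_in_open_separated[OF _ _ oU k(2)] F_nonempty by auto
  show thesis
  proof (rule that[OF \<alpha>(1)])
    fix \<epsilon> assume \<epsilon>: "\<epsilon> \<le> \<alpha>"
    show "parallel_volume (- U) \<epsilon> \<le>
      (\<Sum>w\<in>words_of_length (length k) - {k}. word_ratio r w ^ CARD('d) * parallel_volume (- U) (\<epsilon> / word_ratio r w))"
    proof (rule volume_cover[OF finite_words_of_length words_of_length_subset F_cover_words_of_length])
      fix w y assume w: "w \<in> words_of_length (length k)" and y: "word_map S w y \<in> - U"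
        "y \<in> parallel_set F (\<epsilon> / word_ratio r w)"
      have "y \<notin> U" using word_map_feasible[OF U] w words_of_length_subset y(1) by blast
      moreover have "w \<noteq> k"
      proof
        assume "w = k"
        then have "infdist (word_map S w y) (word_map S k ` F) \<le> \<epsilon>"
          using y(2) similarity_pos[OF sim]
          by (simp add: similarity_infdist[OF sim] parallel_set_def field_simps)
        then have "word_map S w y \<in> {x. infdist x (word_map S k ` F) \<le> \<alpha>}" using \<epsilon> by simp
        then show False using \<alpha>(2) y(1) by blast
      qed
      ultimately show "w \<in> words_of_length (length k) - {k} \<and> y \<in> - U" using w by blast
    qed (use oU in auto)
  qed
qed

lemma open_ifs_image:
  assumes "feasible_open_set N S U" shows "open (ifs_image N S U)"
  using assms similarity_S unfolding feasible_open_set_def ifs_image_def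
  by (intro open_UN ballI similarity_open_image) auto

text \<open>A point of the generator \<open>U - ifs_image N S U\<close> within \<open>\<epsilon>\<close>
of the piece \<open>S i ` F\<close> is the image of a point outside \<open>U\<close>, so the generator
inherits the smallness of the volume outside \<open>U\<close>.\<close>

lemma volume_generator_le:
  assumes U: "feasible_open_set N S U"
  shows "parallel_volume (U - ifs_image N S U) \<epsilon> \<le> (\<Sum>i=1..N. r i ^ CARD('d) * parallel_volume (- U) (\<epsilon> / r i))"
proof -
  have oU: "open U" using U by (simp add: feasible_open_set_def)
  have "parallel_volume (U - ifs_image N S U) \<epsilon> \<le>
    (\<Sum>w\<in>(\<lambda>i. [i]) ` {1..N}. word_ratio r w ^ CARD('d) * parallel_volume (- U) (\<epsilon> / word_ratio r w))"
  proof (rule volume_cover)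
    show "F \<subseteq> (\<Union>w\<in>(\<lambda>i. [i]) ` {1..N}. word_map S w ` F)" using F_eq by simp
  qed (use oU open_ifs_image[OF U] in \<open>auto simp: ifs_image_def\<close>)
  also have "\<dots> = (\<Sum>i=1..N. r i ^ CARD('d) * parallel_volume (- U) (\<epsilon> / r i))"
    by (subst sum.reindex) (auto simp: inj_on_def)
  finally show ?thesis .
qed

text \<open>By the projection property, inside \<open>S i ` U\<close> the parallel set of
\<open>F\<close> is that of \<open>S i ` F\<close>, a scaled copy of the parallel set of \<open>F\<close>
inside \<open>U\<close>. This is where an equality, and not just an inequality, between volumes at
different scales comes from.\<close>

lemma volume_renewal:
  assumes U: "feasible_open_set N S U"
    and proj: "\<And>i z. i \<in> {1..N} \<Longrightarrow> z \<in> S i ` U \<Longrightarrow> infdist z F = infdist z (S i ` F)"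
  shows "parallel_volume U \<epsilon> = (\<Sum>i=1..N. r i ^ CARD('d) * parallel_volume U (\<epsilon> / r i)) + parallel_volume (U - ifs_image N S U) \<epsilon>"
proof -
  have oU: "open U" using U by (simp add: feasible_open_set_def)
  have sub: "ifs_image N S U \<subseteq> U" using U by (auto simp: feasible_open_set_def ifs_image_def)
  have "parallel_volume U \<epsilon> = parallel_volume (ifs_image N S U) \<epsilon> + parallel_volume (U - ifs_image N S U) \<epsilon>"
    using volume_Un[of "ifs_image N S U" "U - ifs_image N S U" \<epsilon>] oU open_ifs_image[OF U] sub
    by (simp add: Un_absorb1)
  also have "parallel_volume (ifs_image N S U) \<epsilon> = measure lebesgue (\<Union>i\<in>{1..N}. parallel_set F \<epsilon> \<inter> S i ` U)"
    unfolding parallel_volume_def ifs_image_def by (simp only: Int_UN_distrib)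
  also have "\<dots> = (\<Sum>i=1..N. measure lebesgue (parallel_set F \<epsilon> \<inter> S i ` U))"
  proof (rule measure_UNION')
    fix i assume "i \<in> {1..N}"
    then show "parallel_set F \<epsilon> \<inter> S i ` U \<in> lmeasurable"
      using similarity_open_image[OF similarity_S oU] by (intro parallel_set_Int_lmeasurable) auto
  next
    show "pairwise (\<lambda>i j. disjnt (parallel_set F \<epsilon> \<inter> S i ` U) (parallel_set F \<epsilon> \<inter> S j ` U)) {1..N}"
      using U unfolding feasible_open_set_def pairwise_def disjnt_def by blast
  qed simp
  also have "\<dots> = (\<Sum>i=1..N. r i ^ CARD('d) * parallel_volume U (\<epsilon> / r i))"
  proof (rule sum.cong[OF refl])
    fix i assume i: "i \<in> {1..N}"
    note sim = similarity_S[OF i]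
    have "infdist (S i y) F \<le> \<epsilon> \<longleftrightarrow> infdist y F \<le> \<epsilon> / r i" if "y \<in> U" for y
      using proj[OF i, of "S i y"] that similarity_pos[OF sim]
      by (simp add: similarity_infdist[OF sim] field_simps)
    then have "parallel_set F \<epsilon> \<inter> S i ` U = S i ` (parallel_set F (\<epsilon> / r i) \<inter> U)"
      by (auto simp: parallel_set_def)
    then show "measure lebesgue (parallel_set F \<epsilon> \<inter> S i ` U) = r i ^ CARD('d) * parallel_volume U (\<epsilon> / r i)"
      using oU by (simp add: parallel_volume_def similarity_measure[OF sim] parallel_set_Int_lmeasurable)
  qed
  finally show ?thesis .
qed

end

section \<open>Renewal equations and logarithmic averages\<close>

text \<open>The value at \<open>t\<close> is at most an average of earlier values, at times that lie at
least the smallest shift back. So a bound on one interval as long as the largest shift propagates to all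
later times.\<close>

lemma renewal_inequality_bounded:
  fixes \<psi> :: "real \<Rightarrow> real"
  assumes I: "finite I" and p: "\<And>i. i \<in> I \<Longrightarrow> 0 \<le> p i" "(\<Sum>i\<in>I. p i) = 1"
    and a: "\<And>i. i \<in> I \<Longrightarrow> 0 < a i"
    and bdd: "\<And>s t. \<exists>B. \<forall>x\<in>{s..t}. \<psi> x \<le> B"
    and step: "\<And>t. T \<le> t \<Longrightarrow> \<psi> t \<le> (\<Sum>i\<in>I. p i * \<psi> (t - a i))"
  obtains B where "\<And>t. T \<le> t \<Longrightarrow> \<psi> t \<le> B"
proof -
  have ne: "finite (a ` I)" "a ` I \<noteq> {}" using I p(2) by auto
  define l m where "l = Min (a ` I)" and "m = Max (a ` I)"
  have l: "0 < l" using Min_in[OF ne] a by (auto simp: l_def)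
  have lm: "l \<le> a i" "a i \<le> m" if "i \<in> I" for i using that ne by (auto simp: l_def m_def)
  \<comment> \<open>The interval is as long as the largest shift \<open>m\<close>; the induction
    extends it by the smallest shift \<open>l\<close>.\<close>
  obtain B where B: "\<And>x. x \<in> {T - m..T} \<Longrightarrow> \<psi> x \<le> B"
    using bdd[of "T - m" T] by blast
  have "\<forall>t. T - m \<le> t \<longrightarrow> t \<le> T + real n * l \<longrightarrow> \<psi> t \<le> B" for n
  proof (induction n)
    case (Suc n)
    show ?case
    proof (intro allI impI)
      fix t assume t: "T - m \<le> t" "t \<le> T + real (Suc n) * l"
      show "\<psi> t \<le> B"
      proof (cases "t \<le> T")
        case False
        then have "\<psi> t \<le> (\<Sum>i\<in>I. p i * \<psi> (t - a i))" by (intro step) simp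
        also have "\<dots> \<le> (\<Sum>i\<in>I. p i * B)"
        proof (intro sum_mono mult_left_mono p)
          fix i assume "i \<in> I"
          from lm[OF this] show "\<psi> (t - a i) \<le> B"
            using Suc t False by (simp add: distrib_right)
        qed
        also have "\<dots> = B" by (simp add: sum_distrib_right[symmetric] p)
        finally show ?thesis .
      qed (use B t in auto)
    qed
  qed (use B in auto)
  moreover have "\<exists>n. t \<le> T + real n * l" for t
    using reals_Archimedean3[OF l, rule_format, of "t - T"] by (metis add.commute diff_le_eq less_imp_le)
  moreover have "0 \<le> m"
  proof -
    obtain i where "i \<in> I" using ne by blast
    then show ?thesis using lm[of i] l by linarith
  qed
  ultimately show thesis using that[of B] by (metis diff_le_eq add_increasing2 order_trans)
qed

text \<open>Subtracting the linear function whose slope is \<open>c\<close> divided by the mean shift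
turns the increment \<open>c\<close> into \<open>0\<close>, and what remains is bounded above.\<close>

lemma renewal_inequality_growth:
  fixes \<phi> :: "real \<Rightarrow> real"
  assumes I: "finite I" and p: "\<And>i. i \<in> I \<Longrightarrow> 0 \<le> p i" "(\<Sum>i\<in>I. p i) = 1"
    and a: "\<And>i. i \<in> I \<Longrightarrow> 0 < a i" and \<eta>: "0 < (\<Sum>i\<in>I. p i * a i)"
    and bdd: "\<And>s t. \<exists>B. \<forall>x\<in>{s..t}. \<phi> x \<le> B"
    and step: "\<forall>\<^sub>F t in at_top. \<phi> t - (\<Sum>i\<in>I. p i * \<phi> (t - a i)) \<le> c"
    and e: "e > 0"
  shows "\<forall>\<^sub>F t in at_top. \<phi> t / t \<le> c / (\<Sum>i\<in>I. p i * a i) + e"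
proof -
  define \<eta> where "\<eta> = (\<Sum>i\<in>I. p i * a i)"
  obtain T where T: "\<And>t. T \<le> t \<Longrightarrow> \<phi> t - (\<Sum>i\<in>I. p i * \<phi> (t - a i)) \<le> c"
    using step by (auto simp: eventually_at_top_linorder)
  define \<psi> where "\<psi> t = \<phi> t - c / \<eta> * t" for t
  have "\<exists>B. \<forall>x\<in>{s..t}. \<psi> x \<le> B" for s t
  proof -
    obtain B where B: "\<And>x. x \<in> {s..t} \<Longrightarrow> \<phi> x \<le> B" using bdd[of s t] by blast
    have "\<psi> x \<le> B + \<bar>c / \<eta>\<bar> * (\<bar>s\<bar> + \<bar>t\<bar>)" if x: "x \<in> {s..t}" for x
    proof -
      have "- (c / \<eta> * x) \<le> \<bar>c / \<eta>\<bar> * \<bar>x\<bar>" using abs_ge_minus_self[of "c / \<eta> * x"] by (simp add: abs_mult)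
      also have "\<dots> \<le> \<bar>c / \<eta>\<bar> * (\<bar>s\<bar> + \<bar>t\<bar>)" using x by (intro mult_left_mono) auto
      finally show ?thesis using B[OF x] by (simp add: \<psi>_def)
    qed
    then show ?thesis by blast
  qed
  moreover have "\<psi> t \<le> (\<Sum>i\<in>I. p i * \<psi> (t - a i))" if "T \<le> t" for t
  proof -
    have "(\<Sum>i\<in>I. p i * \<psi> (t - a i))
      = (\<Sum>i\<in>I. p i * \<phi> (t - a i) - p i * (c / \<eta> * t) + c / \<eta> * (p i * a i))"
      by (intro sum.cong refl) (simp add: \<psi>_def algebra_simps)
    also have "\<dots> = (\<Sum>i\<in>I. p i * \<phi> (t - a i)) - c / \<eta> * t + c / \<eta> * \<eta>"
      by (simp add: sum.distrib sum_subtractf sum_distrib_right[symmetric] sum_distrib_left[symmetric] p \<eta>_def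
          del: times_divide_eq_left)
    finally show ?thesis using T[OF that] \<eta> by (simp add: \<psi>_def \<eta>_def)
  qed
  ultimately obtain B where B: "\<And>t. T \<le> t \<Longrightarrow> \<psi> t \<le> B"
    using renewal_inequality_bounded[of I p a \<psi> T] I p a by blast
  have "\<phi> t / t \<le> c / \<eta> + e" if t: "t \<ge> T" "t \<ge> \<bar>B\<bar> / e" "t > 0" for t
  proof -
    have "B \<le> e * t" using t(2) e by (simp add: pos_divide_le_eq mult.commute)
    then have "\<phi> t \<le> (c / \<eta> + e) * t"
      using B[OF t(1)] unfolding distrib_right \<psi>_def by linarith
    then show ?thesis using t(3) by (simp add: pos_divide_le_eq)
  qed
  then show ?thesis unfolding \<eta>_def[symmetric]
    by (intro eventually_mono[OF eventually_conj[OF eventually_ge_at_top[of T]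
            eventually_conj[OF eventually_ge_at_top[of "\<bar>B\<bar> / e"] eventually_gt_at_top[of 0]]]]) auto
qed

text \<open>Applying the growth bound to \<open>\<phi>\<close> and to \<open>- \<phi>\<close> gives both
inequalities. By monotonicity both functions are bounded above on compact intervals.\<close>

theorem elementary_renewal:
  fixes \<phi> :: "real \<Rightarrow> real"
  assumes I: "finite I" and p: "\<And>i. i \<in> I \<Longrightarrow> 0 \<le> p i" "(\<Sum>i\<in>I. p i) = 1"
    and a: "\<And>i. i \<in> I \<Longrightarrow> 0 < a i" and \<eta>: "0 < (\<Sum>i\<in>I. p i * a i)"
    and mono: "mono \<phi>"
    and lim: "((\<lambda>t. \<phi> t - (\<Sum>i\<in>I. p i * \<phi> (t - a i))) \<longlongrightarrow> L) at_top"
  shows "((\<lambda>t. \<phi> t / t) \<longlongrightarrow> L / (\<Sum>i\<in>I. p i * a i)) at_top"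
proof -
  define \<eta> where "\<eta> = (\<Sum>i\<in>I. p i * a i)"
  have pos: "\<eta> > 0" using \<eta> by (simp add: \<eta>_def)
  have up: "\<forall>\<^sub>F t in at_top. \<phi> t / t \<le> L / \<eta> + e" if e: "e > 0" for e
  proof -
    have "L < L + \<eta> * (e / 2)" using e pos by simp
    from order_tendstoD(2)[OF lim this]
    have "\<forall>\<^sub>F t in at_top. \<phi> t - (\<Sum>i\<in>I. p i * \<phi> (t - a i)) \<le> L + \<eta> * (e / 2)"
      by (rule eventually_mono) simp
    moreover have "\<exists>B. \<forall>x\<in>{s..t}. \<phi> x \<le> B" for s t
      using monoD[OF mono] by (intro exI[of _ "\<phi> t"]) auto
    ultimately have "\<forall>\<^sub>F t in at_top. \<phi> t / t \<le> (L + \<eta> * (e / 2)) / \<eta> + e / 2"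
      unfolding \<eta>_def using e by (intro renewal_inequality_growth[OF I p a \<eta>]) auto
    then show ?thesis using pos by (simp add: add_divide_distrib add.commute)
  qed
  have lo: "\<forall>\<^sub>F t in at_top. L / \<eta> - e \<le> \<phi> t / t" if e: "e > 0" for e
  proof -
    have "L - \<eta> * (e / 2) < L" using e pos by simp
    from order_tendstoD(1)[OF lim this]
    have "\<forall>\<^sub>F t in at_top. - \<phi> t - (\<Sum>i\<in>I. p i * - \<phi> (t - a i)) \<le> - L + \<eta> * (e / 2)"
      by (rule eventually_mono) (simp add: sum_negf)
    moreover have "\<exists>B. \<forall>x\<in>{s..t}. - \<phi> x \<le> B" for s t
      using monoD[OF mono] by (intro exI[of _ "- \<phi> s"]) auto
    ultimately have "\<forall>\<^sub>F t in at_top. - \<phi> t / t \<le> (- L + \<eta> * (e / 2)) / \<eta> + e / 2"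
      unfolding \<eta>_def using e by (intro renewal_inequality_growth[OF I p a \<eta>]) auto
    then show ?thesis using pos by (simp add: add_divide_distrib diff_divide_distrib) (elim eventually_mono, linarith)
  qed
  define l where "l = L / \<eta>"
  note up = up[folded l_def] and lo = lo[folded l_def]
  show ?thesis unfolding \<eta>_def[symmetric] l_def[symmetric]
  proof (rule order_tendstoI)
    fix c assume c: "c < l"
    then have e: "0 < (l - c) / 2" and less: "c < l - (l - c) / 2" by (simp_all add: field_simps)
    from lo[OF e] show "\<forall>\<^sub>F t in at_top. c < \<phi> t / t"
      by (rule eventually_mono) (rule less_le_trans[OF less])
  next
    fix c assume c: "l < c"
    then have e: "0 < (c - l) / 2" and less: "l + (c - l) / 2 < c" by (simp_all add: field_simps)
    from up[OF e] show "\<forall>\<^sub>F t in at_top. \<phi> t / t < c"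
      by (rule eventually_mono) (rule le_less_trans[OF _ less])
  qed
qed

lemma
  fixes f :: "real \<Rightarrow> real"
  assumes r: "r > 0" and A: "A \<subseteq> {0<..}"
  shows set_integrable_powr_dilation: "set_integrable lborel {x. x / r \<in> A} (\<lambda>x. x powr p * f (x / r))
      \<longleftrightarrow> set_integrable lborel A (\<lambda>x. x powr p * f x)"
    and set_integral_powr_dilation: "(LINT x:{x. x / r \<in> A}|lborel. x powr p * f (x / r))
      = r powr (p + 1) * (LINT x:A|lborel. x powr p * f x)"
proof -
  define g where "g x = indicat_real {x. x / r \<in> A} x *\<^sub>R (x powr p * f (x / r))" for x
  have g: "g (0 + r * x) = r powr p * (indicat_real A x *\<^sub>R (x powr p * f x))" for x
    using r A by (auto simp: g_def indicator_def powr_mult)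
  have "integrable lborel (\<lambda>x. g (0 + r * x)) \<longleftrightarrow> integrable lborel g"
    using r by (intro lborel_integrable_real_affine_iff) simp
  then show "set_integrable lborel {x. x / r \<in> A} (\<lambda>x. x powr p * f (x / r))
      \<longleftrightarrow> set_integrable lborel A (\<lambda>x. x powr p * f x)"
    unfolding g using r by (simp add: set_integrable_def g_def[abs_def])
  have "integral\<^sup>L lborel g = \<bar>r\<bar> *\<^sub>R integral\<^sup>L lborel (\<lambda>x. g (0 + r * x))"
    using r by (intro lborel_integral_real_affine) simp
  then show "(LINT x:{x. x / r \<in> A}|lborel. x powr p * f (x / r))
      = r powr (p + 1) * (LINT x:A|lborel. x powr p * f x)"
    unfolding g using r by (simp add: set_lebesgue_integral_def g_def[abs_def] powr_add)
qed

lemma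
  fixes f :: "'i \<Rightarrow> 'a \<Rightarrow> 'b :: {banach, second_countable_topology}"
  assumes "\<And>i. i \<in> I \<Longrightarrow> set_integrable M A (f i)"
  shows set_integrable_sum: "set_integrable M A (\<lambda>x. \<Sum>i\<in>I. f i x)"
    and set_integral_sum: "(LINT x:A|M. \<Sum>i\<in>I. f i x) = (\<Sum>i\<in>I. LINT x:A|M. f i x)"
  using assms by (simp_all add: set_integrable_def set_lebesgue_integral_def scaleR_sum_right)

lemma set_integrable_powr_tail:
  fixes a p :: real
  assumes "0 < a" "p < - 1"
  shows "set_integrable lborel {a..} (\<lambda>x. x powr p)"
proof -
  have "(\<integral>\<^sup>+ x. ennreal (x powr p) * indicator {a..} x \<partial>lborel) = ennreal (0 - a powr (p + 1) / (p + 1))"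
  proof (rule nn_integral_FTC_atLeast)
    fix x assume "a \<le> x"
    then show "((\<lambda>x. x powr (p + 1) / (p + 1)) has_real_derivative x powr p) (at x)"
      using assms by (auto intro!: derivative_eq_intros)
  next
    show "((\<lambda>x. x powr (p + 1) / (p + 1)) \<longlongrightarrow> 0) at_top"
      using assms by (intro tendsto_divide_zero tendsto_neg_powr filterlim_ident) auto
  qed auto
  then have "(\<integral>\<^sup>+ x. ennreal (indicat_real {a..} x *\<^sub>R x powr p) \<partial>lborel) < \<infinity>"
    by (simp add: nn_integral_set_ennreal mult.commute)
  then show ?thesis unfolding set_integrable_def
    by (intro integrableI_nonneg) auto
qed

lemma set_integrable_powr_bounded:
  fixes f :: "real \<Rightarrow> real"
  assumes "set_integrable lborel A (\<lambda>x. x powr p)" "A \<in> sets borel" "f \<in> borel_measurable borel"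
    and "\<And>x. x \<in> A \<Longrightarrow> \<bar>f x\<bar> \<le> C"
  shows "set_integrable lborel A (\<lambda>x. x powr p * f x)"
proof (rule set_integrable_bound)
  show "set_integrable lborel A (\<lambda>x. C * x powr p)"
    using assms(1) by simp
  show "set_borel_measurable lborel A (\<lambda>x. x powr p * f x)"
    using assms(2,3) unfolding set_borel_measurable_def by measurable
  show "AE x in lborel. x \<in> A \<longrightarrow> norm (x powr p * f x) \<le> norm (C * x powr p)"
  proof (intro AE_I2 impI)
    fix x assume "x \<in> A"
    then have "x powr p * \<bar>f x\<bar> \<le> x powr p * \<bar>C\<bar>" using assms(4)[of x] by (intro mult_left_mono) auto
    then show "norm (x powr p * f x) \<le> norm (C * x powr p)" by (simp add: abs_mult mult.commute)
  qed
qed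

lemma set_integrable_powr_mono:
  fixes h :: "real \<Rightarrow> real"
  assumes "0 < a" "mono h" "\<And>x. 0 \<le> h x"
  shows "set_integrable lborel {a..b} (\<lambda>x. x powr p * h x)"
proof (rule set_integrable_powr_bounded)
  show "set_integrable lborel {a..b} (\<lambda>x. x powr p)"
    using assms(1) by (intro borel_integrable_atLeastAtMost' continuous_intros) auto
  show "h \<in> borel_measurable borel" by (rule borel_measurable_mono[OF assms(2)])
  show "\<bar>h x\<bar> \<le> h b" if "x \<in> {a..b}" for x using that assms(3) monoD[OF assms(2), of x b] by auto
qed simp

text \<open>Monotone convergence along the intervals that start at \<open>\<alpha> / (n +
1)\<close>.\<close>

lemma set_integrable_from_0:
  fixes f :: "real \<Rightarrow> real"
  assumes nonneg: "\<And>x. 0 < x \<Longrightarrow> 0 \<le> f x"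
    and int: "\<And>\<delta>. 0 < \<delta> \<Longrightarrow> set_integrable lborel {\<delta>..b} f"
    and \<alpha>: "0 < \<alpha>" and bound: "\<And>\<delta>. 0 < \<delta> \<Longrightarrow> \<delta> \<le> \<alpha> \<Longrightarrow> (LINT x:{\<delta>..b}|lborel. f x) \<le> C"
  shows "set_integrable lborel {0<..b} f"
proof -
  let ?A = "\<lambda>n. {\<alpha> / real (Suc n)..b}"
  let ?I = "\<lambda>n. LINT x:?A n|lborel. f x"
  have pos: "0 < \<alpha> / real (Suc n)" for n using \<alpha> by simp
  have mono_A: "mono ?A"
  proof (intro monoI)
    fix m n :: nat assume "m \<le> n"
    then have "\<alpha> / real (Suc n) \<le> \<alpha> / real (Suc m)" using \<alpha> by (intro divide_left_mono) auto
    then show "?A m \<subseteq> ?A n" by auto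
  qed
  have "?I m \<le> ?I n" if "m \<le> n" for m n
    unfolding set_lebesgue_integral_def
  proof (rule integral_mono)
    fix x show "indicat_real (?A m) x *\<^sub>R f x \<le> indicat_real (?A n) x *\<^sub>R f x"
      using monoD[OF mono_A that] nonneg[of x] less_le_trans[OF pos[of n], of x]
      by (auto simp: indicator_def)
  qed (use int[OF pos] in \<open>auto simp: set_integrable_def\<close>)
  then have "incseq ?I" by (simp add: incseq_def)
  moreover have "?I n \<le> C" for n
    using \<alpha> by (intro bound pos) (simp add: divide_le_eq)
  ultimately obtain l where "?I \<longlonglongrightarrow> l"
    by (meson incseq_convergent)
  then have "set_integrable lborel (\<Union>n. ?A n) f"
    using mono_A int[OF pos] nonneg pos
    by (intro pos_integrable_to_top) (auto intro: less_le_trans)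
  moreover have "(\<Union>n. ?A n) = {0<..b}"
  proof (intro equalityI subsetI)
    fix x assume x: "x \<in> {0<..b}"
    then obtain n where "inverse (real (Suc n)) < x / \<alpha>" using reals_Archimedean[of "x / \<alpha>"] \<alpha> by auto
    then have "\<alpha> / real (Suc n) \<le> x" using \<alpha> by (simp add: field_simps)
    then show "x \<in> (\<Union>n. ?A n)" using x by auto
  next
    fix x assume "x \<in> (\<Union>n. ?A n)"
    then show "x \<in> {0<..b}" using pos by (auto intro: less_le_trans)
  qed
  ultimately show ?thesis by simp
qed

text \<open>Let \<open>K \<delta>\<close> be the integral over \<open>{\<delta>..B}\<close>. Substituting
\<open>x / \<rho> w\<close> in the recursion turns the factor \<open>\<rho> w ^ d\<close> into
\<open>\<rho> w powr D\<close>, and the recursion becomes \<open>K \<delta> \<le> q * K \<delta> +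
C\<close> with \<open>q < 1\<close> and \<open>C\<close> independent of \<open>\<delta>\<close>. Since
\<open>K \<delta>\<close> is finite, this bounds it uniformly.\<close>

lemma subcritical_renewal_integrable:
  fixes h :: "real \<Rightarrow> real"
  assumes W: "finite W" "\<And>w. w \<in> W \<Longrightarrow> 0 < \<rho> w" "\<And>w. w \<in> W \<Longrightarrow> \<rho> w \<le> 1"
    and h: "mono h" "\<And>x. 0 \<le> h x"
    and \<alpha>: "\<alpha> > 0" and rec: "\<And>\<epsilon>. \<epsilon> \<le> \<alpha> \<Longrightarrow> h \<epsilon> \<le> (\<Sum>w\<in>W. \<rho> w ^ d * h (\<epsilon> / \<rho> w))"
    and less: "(\<Sum>w\<in>W. \<rho> w powr D) < 1"
  shows "set_integrable lborel {0<..b} (\<lambda>x. x powr (D - real d - 1) * h x)"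
proof -
  let ?p = "D - real d - 1"
  let ?f = "\<lambda>x. x powr ?p * h x"
  have "finite ((\<lambda>w. \<alpha> / \<rho> w) ` W \<union> {\<alpha>, b})" using W by simp
  then obtain B where "\<And>x. x \<in> (\<lambda>w. \<alpha> / \<rho> w) ` W \<union> {\<alpha>, b} \<Longrightarrow> x \<le> B"
    using bdd_above_finite unfolding bdd_above_def by metis
  then have B: "\<alpha> \<le> B" "b \<le> B" "\<And>w. w \<in> W \<Longrightarrow> \<alpha> / \<rho> w \<le> B" by auto
  have int: "set_integrable lborel {s..t} ?f" if "0 < s" for s t
    using set_integrable_powr_mono[OF that h] .
  define C where "C = (LINT x:{\<alpha><..B}|lborel. ?f x)"
  let ?K = "\<lambda>\<delta>. LINT x:{\<delta>..B}|lborel. ?f x"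
  have bound: "?K \<delta> \<le> C / (1 - (\<Sum>w\<in>W. \<rho> w powr D))" if \<delta>: "0 < \<delta>" "\<delta> \<le> \<alpha>" for \<delta>
  proof -
    have split: "{\<delta>..B} = {\<delta>..\<alpha>} \<union> {\<alpha><..B}" using \<delta> B by auto
    have "set_integrable lborel {\<alpha><..B} ?f"
      by (rule set_integrable_subset[OF int[OF \<alpha>, of B]]) auto
    then have "?K \<delta> = (LINT x:{\<delta>..\<alpha>}|lborel. ?f x) + C"
      unfolding split C_def using int[OF \<delta>(1)] by (intro set_integral_Un) auto
    have terms: "set_integrable lborel {\<delta>..\<alpha>} (\<lambda>x. x powr ?p * h (x / \<rho> w))" if "w \<in> W" for w
    proof (rule set_integrable_powr_mono[OF \<delta>(1)])
      show "mono (\<lambda>x. h (x / \<rho> w))"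
        using W(2)[OF that] by (intro monoI monoD[OF h(1)] divide_right_mono) auto
    qed (rule h(2))
    note \<open>?K \<delta> = (LINT x:{\<delta>..\<alpha>}|lborel. ?f x) + C\<close>
    also have "(LINT x:{\<delta>..\<alpha>}|lborel. ?f x) \<le>
        (LINT x:{\<delta>..\<alpha>}|lborel. \<Sum>w\<in>W. \<rho> w ^ d * (x powr ?p * h (x / \<rho> w)))"
    proof (rule set_integral_mono[OF int[OF \<delta>(1)]])
      show "set_integrable lborel {\<delta>..\<alpha>} (\<lambda>x. \<Sum>w\<in>W. \<rho> w ^ d * (x powr ?p * h (x / \<rho> w)))"
        by (intro set_integrable_sum set_integrable_mult_right terms)
      fix x assume "x \<in> {\<delta>..\<alpha>}"
      then have "x powr ?p * h x \<le> x powr ?p * (\<Sum>w\<in>W. \<rho> w ^ d * h (x / \<rho> w))"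
        by (intro mult_left_mono rec) auto
      then show "?f x \<le> (\<Sum>w\<in>W. \<rho> w ^ d * (x powr ?p * h (x / \<rho> w)))"
        by (simp add: sum_distrib_left mult_ac)
    qed
    also have "\<dots> = (\<Sum>w\<in>W. \<rho> w ^ d * (LINT x:{\<delta>..\<alpha>}|lborel. x powr ?p * h (x / \<rho> w)))"
      using terms by (subst set_integral_sum) auto
    also have "\<dots> \<le> (\<Sum>w\<in>W. \<rho> w powr D * ?K \<delta>)"
    proof (rule sum_mono)
      fix w assume w: "w \<in> W"
      note \<rho> = W(2,3)[OF w]
      have set: "{\<delta>..\<alpha>} = {x. x / \<rho> w \<in> {\<delta> / \<rho> w..\<alpha> / \<rho> w}}"
        using \<rho> by (auto simp: divide_le_cancel)
      have "0 < \<delta> / \<rho> w" using \<rho> \<delta> by simp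
      then have pos: "{\<delta> / \<rho> w..\<alpha> / \<rho> w} \<subseteq> {0<..}" by (meson atLeastAtMost_iff greaterThan_iff less_le_trans subsetI)
      have "(LINT x:{\<delta>..\<alpha>}|lborel. x powr ?p * h (x / \<rho> w)) =
         \<rho> w powr (?p + 1) * (LINT x:{\<delta> / \<rho> w..\<alpha> / \<rho> w}|lborel. ?f x)"
        unfolding set by (rule set_integral_powr_dilation[OF \<rho>(1) pos])
      moreover have "\<rho> w ^ d * \<rho> w powr (?p + 1) = \<rho> w powr D"
        using \<rho> by (simp add: powr_realpow[symmetric] powr_add[symmetric])
      moreover have "(LINT x:{\<delta> / \<rho> w..\<alpha> / \<rho> w}|lborel. ?f x) \<le> ?K \<delta>"
        unfolding set_lebesgue_integral_def
      proof (rule integral_mono)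
        have "\<delta> \<le> \<delta> / \<rho> w" using \<rho> \<delta> by (simp add: le_divide_eq)
        then show "indicat_real {\<delta> / \<rho> w..\<alpha> / \<rho> w} x *\<^sub>R ?f x \<le> indicat_real {\<delta>..B} x *\<^sub>R ?f x" for x
          using B(3)[OF w] h(2)[of x] by (auto simp: indicator_def)
      qed (use int[OF \<delta>(1)] int[OF \<open>0 < \<delta> / \<rho> w\<close>] in \<open>simp_all add: set_integrable_def\<close>)
      ultimately show "\<rho> w ^ d * (LINT x:{\<delta>..\<alpha>}|lborel. x powr ?p * h (x / \<rho> w)) \<le> \<rho> w powr D * ?K \<delta>"
        by (simp add: mult.assoc[symmetric] mult_left_mono)
    qed
    finally have "?K \<delta> \<le> (\<Sum>w\<in>W. \<rho> w powr D) * ?K \<delta> + C" by (simp add: sum_distrib_right)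
    then show ?thesis using less by (simp add: pos_le_divide_eq algebra_simps)
  qed
  have "set_integrable lborel {0<..B} ?f"
    by (rule set_integrable_from_0[OF _ int \<alpha> bound]) (auto simp: h)
  then show ?thesis by (rule set_integrable_subset) (use B in auto)
qed

text \<open>The part of the integral over \<open>{\<delta>..b}\<close> is at least \<open>c * (ln b - ln
\<delta>)\<close>, and the rest does not depend on \<open>\<delta>\<close>.\<close>

lemma log_average_ge:
  fixes u :: "real \<Rightarrow> real"
  assumes int: "\<And>\<delta>. 0 < \<delta> \<Longrightarrow> set_integrable lborel {\<delta>..1} (\<lambda>\<epsilon>. u \<epsilon> / \<epsilon>)"
    and ge: "\<forall>\<^sub>F \<epsilon> in at_right 0. c \<le> u \<epsilon>"
    and lim: "((\<lambda>\<delta>. 1 / \<bar>ln \<delta>\<bar> * (LINT \<epsilon>:{\<delta>..1}|lborel. u \<epsilon> / \<epsilon>)) \<longlongrightarrow> m) (at_right 0)"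
  shows "c \<le> m"
proof -
  obtain b0 where b0: "b0 > 0" "\<And>\<epsilon>. 0 < \<epsilon> \<Longrightarrow> \<epsilon> < b0 \<Longrightarrow> c \<le> u \<epsilon>"
    using ge unfolding eventually_at_right_field by auto
  define b where "b = min 1 (b0 / 2)"
  have b: "0 < b" "b \<le> 1" "b < b0" using b0(1) by (auto simp: b_def)
  define K where "K = (LINT \<epsilon>:{b<..1}|lborel. u \<epsilon> / \<epsilon>)"
  have low: "(c * (ln b - ln \<delta>) + K) / \<bar>ln \<delta>\<bar> \<le> 1 / \<bar>ln \<delta>\<bar> * (LINT \<epsilon>:{\<delta>..1}|lborel. u \<epsilon> / \<epsilon>)"
    if \<delta>: "0 < \<delta>" "\<delta> < b" for \<delta>
  proof -
    have "has_bochner_integral lborel (\<lambda>x. inverse x * indicator {\<delta>..b} x) (ln b - ln \<delta>)"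
      using \<delta> by (intro has_bochner_integral_FTC_Icc_nonneg)
        (auto intro!: derivative_eq_intros simp: inverse_eq_divide)
    then have "set_integrable lborel {\<delta>..b} inverse" "(LINT x:{\<delta>..b}|lborel. inverse x) = ln b - ln \<delta>"
      by (auto simp: has_bochner_integral_iff set_integrable_def set_lebesgue_integral_def mult.commute)
    then have intc: "set_integrable lborel {\<delta>..b} (\<lambda>x. c * inverse x)"
      and valc: "(LINT x:{\<delta>..b}|lborel. c * inverse x) = c * (ln b - ln \<delta>)"
      by simp_all
    have "{\<delta>..1} = {\<delta>..b} \<union> {b<..1}" using \<delta> b by auto
    then have "(LINT \<epsilon>:{\<delta>..1}|lborel. u \<epsilon> / \<epsilon>) = (LINT \<epsilon>:{\<delta>..b}|lborel. u \<epsilon> / \<epsilon>) + K"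
      unfolding K_def using \<delta> b int[OF \<delta>(1)]
      by (simp only:) (intro set_integral_Un, auto intro: set_integrable_subset)
    moreover have "c * (ln b - ln \<delta>) \<le> (LINT \<epsilon>:{\<delta>..b}|lborel. u \<epsilon> / \<epsilon>)"
      unfolding valc[symmetric]
    proof (rule set_integral_mono[OF intc])
      show "set_integrable lborel {\<delta>..b} (\<lambda>\<epsilon>. u \<epsilon> / \<epsilon>)"
        using int[OF \<delta>(1)] b by (auto intro: set_integrable_subset)
      show "c * inverse x \<le> u x / x" if "x \<in> {\<delta>..b}" for x
        using that \<delta> b b0(2)[of x] by (auto simp: divide_inverse intro!: mult_right_mono)
    qed
    ultimately show ?thesis by (simp add: divide_right_mono)
  qed
  have "((\<lambda>\<delta>. (c * (ln b - ln \<delta>) + K) / \<bar>ln \<delta>\<bar>) \<longlongrightarrow> c) (at_right 0)"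
  proof -
    have top: "filterlim (\<lambda>\<delta>::real. - ln \<delta>) at_top (at_right 0)"
      using ln_at_0 by (simp add: filterlim_uminus_at_top)
    have "((\<lambda>\<delta>. (c * ln b + K) / (- ln \<delta>) + c) \<longlongrightarrow> 0 + c) (at_right 0)"
      by (intro tendsto_add tendsto_const tendsto_divide_0[OF tendsto_const] filterlim_at_top_imp_at_infinity[OF top])
    moreover have "\<forall>\<^sub>F \<delta> in at_right 0. (c * ln b + K) / (- ln \<delta>) + c = (c * (ln b - ln \<delta>) + K) / \<bar>ln \<delta>\<bar>"
      unfolding eventually_at_right_field
      by (intro exI[of _ 1]) (auto simp: field_simps)
    ultimately show ?thesis by (simp add: filterlim_cong)
  qed
  moreover have "\<forall>\<^sub>F \<delta> in at_right 0. (c * (ln b - ln \<delta>) + K) / \<bar>ln \<delta>\<bar> \<le>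
      1 / \<bar>ln \<delta>\<bar> * (LINT \<epsilon>:{\<delta>..1}|lborel. u \<epsilon> / \<epsilon>)"
    unfolding eventually_at_right_field using low b by blast
  ultimately show ?thesis
    by (intro tendsto_le[OF _ lim]) auto
qed

text \<open>The logarithmic mean is a Cesaro mean: it agrees with the limit whenever that exists. As the
limit is taken in the extended reals, finiteness of the mean also excludes infinite limits.\<close>

lemma log_average_eq_limit:
  fixes u :: "real \<Rightarrow> real"
  assumes int: "\<And>\<delta>. 0 < \<delta> \<Longrightarrow> set_integrable lborel {\<delta>..1} (\<lambda>\<epsilon>. u \<epsilon> / \<epsilon>)"
    and u: "((\<lambda>\<epsilon>. ereal (u \<epsilon>)) \<longlongrightarrow> M) (at_right 0)"
    and lim: "((\<lambda>\<delta>. 1 / \<bar>ln \<delta>\<bar> * (LINT \<epsilon>:{\<delta>..1}|lborel. u \<epsilon> / \<epsilon>)) \<longlongrightarrow> m) (at_right 0)"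
  shows "M = ereal m"
proof (rule antisym)
  show "M \<le> ereal m"
  proof (rule ccontr)
    assume "\<not> ?thesis"
    then obtain c where c: "ereal m < ereal c" "ereal c < M" using ereal_dense2[of "ereal m" M] by (auto simp: not_le)
    have "\<forall>\<^sub>F \<epsilon> in at_right 0. c \<le> u \<epsilon>"
      using order_tendstoD(1)[OF u c(2)] by (auto elim: eventually_mono)
    then show False using log_average_ge[OF int _ lim, of c] c(1) by simp
  qed
  show "ereal m \<le> M"
  proof (rule ccontr)
    assume "\<not> ?thesis"
    then obtain c where c: "M < ereal c" "ereal c < ereal m" using ereal_dense2[of M "ereal m"] by (auto simp: not_le)
    have ev: "\<forall>\<^sub>F \<epsilon> in at_right 0. - c \<le> - u \<epsilon>"
      using order_tendstoD(2)[OF u c(1)] by (auto elim: eventually_mono)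
    have "((\<lambda>\<delta>. 1 / \<bar>ln \<delta>\<bar> * (LINT \<epsilon>:{\<delta>..1}|lborel. - u \<epsilon> / \<epsilon>)) \<longlongrightarrow> - m) (at_right 0)"
    proof -
      have "(LINT \<epsilon>:{\<delta>..1}|lborel. - u \<epsilon> / \<epsilon>) = - (LINT \<epsilon>:{\<delta>..1}|lborel. u \<epsilon> / \<epsilon>)" for \<delta>
        by (simp add: set_lebesgue_integral_def)
      then show ?thesis using tendsto_minus[OF lim] by simp
    qed
    then have "- c \<le> - m"
      using int by (intro log_average_ge[OF _ ev]) (auto simp: set_integrable_def)
    then show False using c(2) by simp
  qed
qed

section \<open>The average Minkowski content\<close>

text \<open>The open set found above together with the assumptions on the dimension. The word
\<open>k\<close> names a cylinder of \<open>F\<close> inside \<open>U\<close>; it witnesses that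
\<open>U\<close> is strong.\<close>

locale projecting_open_set = similarity_system N S r F
  for N :: nat and S :: "nat \<Rightarrow> real ^ 'd \<Rightarrow> real ^ 'd" and r :: "nat \<Rightarrow> real" and F +
  fixes D :: real and U :: "(real ^ 'd) set" and k :: "nat list"
  assumes dimension: "similarity_dimension N r D" and D_less: "D < real CARD('d)"
    and feasible: "feasible_open_set N S U"
    and cylinder: "k \<in> words" "word_map S k ` F \<subseteq> U"
    and projection: "\<And>i z. i \<in> {1..N} \<Longrightarrow> z \<in> S i ` U \<Longrightarrow> infdist z F = infdist z (S i ` F)"
begin

abbreviation "\<Gamma> \<equiv> U - ifs_image N S U"

abbreviation weighted_volume :: "(real ^ 'd) set \<Rightarrow> real \<Rightarrow> real" where
  "weighted_volume Q \<equiv> \<lambda>\<epsilon>. \<epsilon> powr (D - real CARD('d) - 1) * parallel_volume Q \<epsilon>"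

lemma U_props: "open U" "U \<noteq> {}" "bounded U"
  using feasible by (auto simp: feasible_open_set_def)

lemma Q_sets: "U \<in> sets lebesgue" "- U \<in> sets lebesgue" "\<Gamma> \<in> sets lebesgue"
  using U_props(1) open_ifs_image[OF feasible] by auto

lemma weighted_tail_integrable:
  assumes Q: "Q \<in> sets lebesgue" "Q \<subseteq> U" and a: "0 < a"
  shows "set_integrable lborel {a..} (weighted_volume Q)"
proof (rule set_integrable_powr_bounded)
  show "set_integrable lborel {a..} (\<lambda>x. x powr (D - real CARD('d) - 1))"
    using D_less by (intro set_integrable_powr_tail a) simp
  show "parallel_volume Q \<in> borel_measurable borel" by (rule borel_measurable_mono[OF volume_mono[OF Q(1)]])
  have "U \<in> lmeasurable" using U_props by (simp add: lmeasurable_open)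
  then have "parallel_volume Q x \<le> measure lebesgue U" for x
    unfolding parallel_volume_def using Q(2) fmeasurableD[OF parallel_set_Int_lmeasurable[OF Q(1)]]
    by (intro measure_mono_fmeasurable) auto
  then show "\<bar>parallel_volume Q x\<bar> \<le> measure lebesgue U" for x using volume_nonneg[of Q x] by simp
qed simp

lemma weighted_outside_integrable: "set_integrable lborel {0<..b} (weighted_volume (- U))"
proof -
  obtain \<alpha> where \<alpha>: "\<alpha> > 0" and rec: "\<And>\<epsilon>. \<epsilon> \<le> \<alpha> \<Longrightarrow> parallel_volume (- U) \<epsilon> \<le>
      (\<Sum>w\<in>words_of_length (length k) - {k}. word_ratio r w ^ CARD('d) * parallel_volume (- U) (\<epsilon> / word_ratio r w))"
    using volume_outside_le[OF feasible cylinder] by blast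
  let ?W = "words_of_length (length k)"
  have "k \<in> ?W" using cylinder(1) by (auto simp: words_of_length_def words_def)
  then have "(\<Sum>w\<in>?W - {k}. word_ratio r w powr D) = 1 - word_ratio r k powr D"
    using sum_words_of_length[OF dimension, of "length k"] finite_words_of_length
    by (simp add: sum_diff1)
  also have "\<dots> < 1" using word_ratio_pos[OF cylinder(1)] by simp
  finally show ?thesis
    using words_of_length_subset finite_words_of_length word_ratio_pos word_ratio_le_1 volume_nonneg
    by (intro subcritical_renewal_integrable[OF _ _ _ volume_mono[OF Q_sets(2)] _ \<alpha> rec]) blast+
qed

lemma weighted_generator_integrable: "set_integrable lborel {0<..} (weighted_volume \<Gamma>)"
proof -
  let ?p = "D - real CARD('d) - 1"
  let ?g = "\<lambda>x. \<Sum>i=1..N. r i ^ CARD('d) * (x powr ?p * parallel_volume (- U) (x / r i))"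
  have g: "set_integrable lborel {0<..1} ?g"
  proof (intro set_integrable_sum set_integrable_mult_right)
    fix i assume i: "i \<in> {1..N}"
    have set: "{0<..1} = {x. x / r i \<in> {0<..1 / r i}}"
      using ratio_pos[OF i] by (auto simp: zero_less_divide_iff divide_le_cancel)
    have sub: "{0<..1 / r i} \<subseteq> {0<..}" by auto
    show "set_integrable lborel {0<..1} (\<lambda>x. x powr ?p * parallel_volume (- U) (x / r i))"
      unfolding set set_integrable_powr_dilation[OF ratio_pos[OF i] sub]
      by (rule weighted_outside_integrable)
  qed
  have "set_integrable lborel {0<..1} (weighted_volume \<Gamma>)"
  proof (rule set_integrable_bound[OF g])
    have "parallel_volume \<Gamma> \<in> borel_measurable borel" by (rule borel_measurable_mono[OF volume_mono[OF Q_sets(3)]])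
    then show "set_borel_measurable lborel {0<..1} (weighted_volume \<Gamma>)"
      unfolding set_borel_measurable_def by measurable
    have "norm (weighted_volume \<Gamma> x) \<le> norm (?g x)" for x
    proof -
      have "norm (weighted_volume \<Gamma> x) = x powr ?p * parallel_volume \<Gamma> x" using volume_nonneg[of \<Gamma> x] by simp
      also have "\<dots> \<le> x powr ?p * (\<Sum>i=1..N. r i ^ CARD('d) * parallel_volume (- U) (x / r i))"
        by (intro mult_left_mono volume_generator_le[OF feasible]) simp
      also have "\<dots> = ?g x" by (simp add: sum_distrib_left mult_ac)
      finally show ?thesis by simp
    qed
    then show "AE x in lborel. x \<in> {0<..1} \<longrightarrow> norm (weighted_volume \<Gamma> x) \<le> norm (?g x)" by simp
  qed
  moreover have "set_integrable lborel {1..} (weighted_volume \<Gamma>)"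
    by (rule weighted_tail_integrable[OF Q_sets(3)]) auto
  ultimately have "set_integrable lborel ({0<..1} \<union> {1..}) (weighted_volume \<Gamma>)"
    by (rule set_integrable_Un) auto
  moreover have "{0<..1} \<union> {1..} = {0::real<..}" by auto
  ultimately show ?thesis by simp
qed

text \<open>The integrals run from \<open>\<delta>\<close> to infinity, where they converge because
\<open>D < d\<close>. This choice leaves the renewal equation of the tails without boundary terms at the
upper end.\<close>

definition tail :: "real \<Rightarrow> real" where
  "tail \<delta> = (LINT \<epsilon>:{\<delta>..}|lborel. weighted_volume U \<epsilon>)"

lemma tail_antimono:
  assumes "0 < \<delta>" "\<delta> \<le> \<delta>'" shows "tail \<delta>' \<le> tail \<delta>"
  unfolding tail_def set_lebesgue_integral_def
proof (rule integral_mono)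
  show "indicat_real {\<delta>'..} x *\<^sub>R weighted_volume U x \<le> indicat_real {\<delta>..} x *\<^sub>R weighted_volume U x" for x
    using assms volume_nonneg[of U x] by (auto simp: indicator_def)
qed (use assms weighted_tail_integrable[OF Q_sets(1) order_refl] in \<open>simp_all add: set_integrable_def\<close>)

text \<open>The integrated form of the renewal equation for volumes; the substitution \<open>\<epsilon> /
r i\<close> turns the factor \<open>r i ^ CARD('d)\<close> into \<open>r i powr D\<close>.\<close>

lemma tail_renewal:
  assumes \<delta>: "0 < \<delta>"
  shows "tail \<delta> - (\<Sum>i=1..N. r i powr D * tail (\<delta> / r i)) = (LINT \<epsilon>:{\<delta>..}|lborel. weighted_volume \<Gamma> \<epsilon>)"
proof -
  let ?p = "D - real CARD('d) - 1"
  have dil: "set_integrable lborel {\<delta>..} (\<lambda>x. x powr ?p * parallel_volume U (x / r i)) \<and>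
      r i ^ CARD('d) * (LINT x:{\<delta>..}|lborel. x powr ?p * parallel_volume U (x / r i)) = r i powr D * tail (\<delta> / r i)"
    if i: "i \<in> {1..N}" for i
  proof -
    note ri = ratio_pos[OF i]
    have set: "{\<delta>..} = {x. x / r i \<in> {\<delta> / r i..}}" using ri by (auto simp: divide_le_cancel)
    have pos: "0 < \<delta> / r i" using ri \<delta> by simp
    then have sub: "{\<delta> / r i..} \<subseteq> {0<..}" by (meson atLeast_iff greaterThan_iff less_le_trans subsetI)
    have "r i ^ CARD('d) * r i powr (?p + 1) = r i powr D"
      using ri by (simp add: powr_realpow[symmetric] powr_add[symmetric])
    then have "r i ^ CARD('d) * (r i powr (?p + 1) * tail (\<delta> / r i)) = r i powr D * tail (\<delta> / r i)"
      by (simp only: mult.assoc[symmetric])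
    then show ?thesis
      unfolding set set_integral_powr_dilation[OF ri sub] set_integrable_powr_dilation[OF ri sub]
      using weighted_tail_integrable[OF Q_sets(1) order_refl pos] by (simp add: tail_def)
  qed
  have int: "set_integrable lborel {\<delta>..} (\<lambda>x. \<Sum>i=1..N. r i ^ CARD('d) * (x powr ?p * parallel_volume U (x / r i)))"
    using dil by (intro set_integrable_sum set_integrable_mult_right) auto
  have "(LINT \<epsilon>:{\<delta>..}|lborel. weighted_volume \<Gamma> \<epsilon>) =
     (LINT x:{\<delta>..}|lborel. weighted_volume U x - (\<Sum>i=1..N. r i ^ CARD('d) * (x powr ?p * parallel_volume U (x / r i))))"
  proof (rule set_lebesgue_integral_cong)
    have "weighted_volume \<Gamma> x = weighted_volume U x - (\<Sum>i=1..N. r i ^ CARD('d) * (x powr ?p * parallel_volume U (x / r i)))" for x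
      by (subst volume_renewal[OF feasible projection]) (simp_all add: algebra_simps sum_distrib_left)
    then show "\<forall>x. x \<in> {\<delta>..} \<longrightarrow> weighted_volume \<Gamma> x =
      weighted_volume U x - (\<Sum>i=1..N. r i ^ CARD('d) * (x powr ?p * parallel_volume U (x / r i)))" by blast
  qed simp
  also have "\<dots> = tail \<delta> - (LINT x:{\<delta>..}|lborel. \<Sum>i=1..N. r i ^ CARD('d) * (x powr ?p * parallel_volume U (x / r i)))"
    unfolding tail_def by (intro set_integral_diff(2) weighted_tail_integrable[OF Q_sets(1) order_refl \<delta>] int)
  also have "(LINT x:{\<delta>..}|lborel. \<Sum>i=1..N. r i ^ CARD('d) * (x powr ?p * parallel_volume U (x / r i)))
     = (\<Sum>i=1..N. r i powr D * tail (\<delta> / r i))"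
    using dil by (subst set_integral_sum) auto
  finally show ?thesis by simp
qed

lemma generator_tail_tendsto:
  "((\<lambda>\<delta>. LINT \<epsilon>:{\<delta>..}|lborel. weighted_volume \<Gamma> \<epsilon>) \<longlongrightarrow> (LINT \<epsilon>:{0<..}|lborel. weighted_volume \<Gamma> \<epsilon>)) (at_right 0)"
proof -
  let ?f = "weighted_volume \<Gamma>"
  have int: "set_integrable lborel A ?f" if "A \<in> sets borel" "A \<subseteq> {0<..}" for A
    using set_integrable_subset[OF weighted_generator_integrable] that by simp
  have "((\<lambda>\<delta>. (LINT \<epsilon>:{\<delta>..1}|lborel. ?f \<epsilon>) + (LINT \<epsilon>:{1<..}|lborel. ?f \<epsilon>))
     \<longlongrightarrow> (LINT \<epsilon>:{0<..1}|lborel. ?f \<epsilon>) + (LINT \<epsilon>:{1<..}|lborel. ?f \<epsilon>)) (at_right 0)"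
    by (intro tendsto_add tendsto_const tendsto_set_lebesgue_integral_at_right int) auto
  moreover have "(LINT \<epsilon>:{0<..1}|lborel. ?f \<epsilon>) + (LINT \<epsilon>:{1<..}|lborel. ?f \<epsilon>) = (LINT \<epsilon>:{0<..}|lborel. ?f \<epsilon>)"
  proof -
    have split: "{0::real<..} = {0<..1} \<union> {1<..}" by auto
    show ?thesis unfolding split by (rule set_integral_Un[symmetric]) (auto intro!: int)
  qed
  moreover have "\<forall>\<^sub>F \<delta> in at_right 0. (LINT \<epsilon>:{\<delta>..1}|lborel. ?f \<epsilon>) + (LINT \<epsilon>:{1<..}|lborel. ?f \<epsilon>)
      = (LINT \<epsilon>:{\<delta>..}|lborel. ?f \<epsilon>)"
    unfolding eventually_at_right_field
  proof (intro exI[of _ 1] conjI allI impI)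
    fix \<delta> :: real assume \<delta>: "0 < \<delta>" "\<delta> < 1"
    then have split: "{\<delta>..} = {\<delta>..1} \<union> {1<..}" by auto
    show "(LINT \<epsilon>:{\<delta>..1}|lborel. ?f \<epsilon>) + (LINT \<epsilon>:{1<..}|lborel. ?f \<epsilon>) = (LINT \<epsilon>:{\<delta>..}|lborel. ?f \<epsilon>)"
      unfolding split using \<delta> by (intro set_integral_Un[symmetric] int) auto
  qed simp
  ultimately show ?thesis by (simp add: filterlim_cong)
qed

text \<open>On the scale \<open>t = - ln \<delta>\<close> the tails form a monotone function, and
dividing \<open>\<delta>\<close> by \<open>r i\<close> shifts \<open>t\<close> by \<open>- ln (r
i)\<close>. The mean shift with respect to the weights \<open>r i powr D\<close> is
\<open>\<eta>\<close>.\<close>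

lemma tail_asymptotics:
  assumes \<eta>: "\<eta> = - (\<Sum>i=1..N. r i powr D * ln (r i))"
  shows "((\<lambda>\<delta>. tail \<delta> / \<bar>ln \<delta>\<bar>) \<longlongrightarrow> 1 / \<eta> * (LINT \<epsilon>:{0<..}|lborel. weighted_volume \<Gamma> \<epsilon>)) (at_right 0)"
proof -
  let ?L = "LINT \<epsilon>:{0<..}|lborel. weighted_volume \<Gamma> \<epsilon>"
  define \<phi> where "\<phi> t = tail (exp (- t))" for t
  have \<eta>': "(\<Sum>i=1..N. r i powr D * - ln (r i)) = \<eta>" by (simp add: \<eta> sum_negf)
  have "((\<lambda>t. \<phi> t / t) \<longlongrightarrow> ?L / (\<Sum>i=1..N. r i powr D * - ln (r i))) at_top"
  proof (rule elementary_renewal)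
    show "(\<Sum>i=1..N. r i powr D) = 1" using dimension by (simp add: similarity_dimension_def)
    show ln: "0 < - ln (r i)" if "i \<in> {1..N}" for i using ratio_pos[OF that] ratio_less_1[OF that] by simp
    show "0 < (\<Sum>i=1..N. r i powr D * - ln (r i))"
    proof (rule sum_pos)
      fix i assume i: "i \<in> {1..N}"
      show "0 < r i powr D * - ln (r i)" using ratio_pos[OF i] ln[OF i] by (intro mult_pos_pos) auto
    qed (use N_ge_2 in auto)
    show "mono \<phi>" unfolding \<phi>_def by (intro monoI tail_antimono) auto
    have exp0: "filterlim (\<lambda>t::real. exp (- t)) (at_right 0) at_top"
      by (auto simp: filterlim_at intro!: filterlim_compose[OF exp_at_bot] filterlim_uminus_at_bot_at_top)
    have "\<phi> t - (\<Sum>i=1..N. r i powr D * \<phi> (t - - ln (r i))) = (LINT \<epsilon>:{exp (- t)..}|lborel. weighted_volume \<Gamma> \<epsilon>)" for t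
    proof -
      have "\<phi> (t - - ln (r i)) = tail (exp (- t) / r i)" if "i \<in> {1..N}" for i
        using ratio_pos[OF that] by (simp add: \<phi>_def exp_diff)
      then show ?thesis using tail_renewal[of "exp (- t)"] by (simp add: \<phi>_def)
    qed
    then show "((\<lambda>t. \<phi> t - (\<Sum>i=1..N. r i powr D * \<phi> (t - - ln (r i)))) \<longlongrightarrow> ?L) at_top"
      using filterlim_compose[OF generator_tail_tendsto exp0] by simp
  qed auto
  moreover have "filterlim (\<lambda>\<delta>::real. - ln \<delta>) at_top (at_right 0)"
    using ln_at_0 by (simp add: filterlim_uminus_at_top)
  ultimately have "((\<lambda>\<delta>. \<phi> (- ln \<delta>) / (- ln \<delta>)) \<longlongrightarrow> ?L / \<eta>) (at_right 0)"
    unfolding \<eta>' by (rule filterlim_compose)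
  moreover have "\<forall>\<^sub>F \<delta> in at_right 0. \<phi> (- ln \<delta>) / (- ln \<delta>) = tail \<delta> / \<bar>ln \<delta>\<bar>"
    unfolding eventually_at_right_field by (intro exI[of _ 1]) (auto simp: \<phi>_def)
  ultimately show ?thesis by (simp add: filterlim_cong)
qed

lemma weighted_volume_integrable_Icc: "0 < \<delta> \<Longrightarrow> set_integrable lborel {\<delta>..b} (weighted_volume Q)" if "Q \<in> sets lebesgue"
  by (intro set_integrable_powr_mono volume_mono volume_nonneg that)

text \<open>The integral over \<open>{\<delta>..1}\<close> of the full volume differs from the tail by
the part above \<open>1\<close> and by the part outside \<open>U\<close>. Both stay bounded as
\<open>\<delta>\<close> tends to \<open>0\<close>, so division by \<open>\<bar>ln \<delta>\<bar>\<close>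
removes them.\<close>

theorem average_content:
  assumes \<eta>: "\<eta> = - (\<Sum>i=1..N. r i powr D * ln (r i))"
  shows "((\<lambda>\<delta>. 1 / \<bar>ln \<delta>\<bar> * (LINT \<epsilon>:{\<delta>..1}|lborel. weighted_volume UNIV \<epsilon>)) \<longlongrightarrow>
      1 / \<eta> * (LINT \<epsilon>:{0<..}|lborel. weighted_volume \<Gamma> \<epsilon>)) (at_right 0)"
proof -
  let ?L = "1 / \<eta> * (LINT \<epsilon>:{0<..}|lborel. weighted_volume \<Gamma> \<epsilon>)"
  define out where "out \<delta> = (LINT \<epsilon>:{\<delta>..1}|lborel. weighted_volume (- U) \<epsilon>)" for \<delta>
  define far where "far = (LINT \<epsilon>:{1<..}|lborel. weighted_volume U \<epsilon>)"
  have top: "filterlim (\<lambda>\<delta>::real. \<bar>ln \<delta>\<bar>) at_infinity (at_right 0)"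
    using filterlim_at_infinity_imp_norm_at_top[OF filterlim_at_bot_imp_at_infinity[OF ln_at_0]]
    by (intro filterlim_at_top_imp_at_infinity) simp
  have "(out \<longlongrightarrow> (LINT \<epsilon>:{0<..1}|lborel. weighted_volume (- U) \<epsilon>)) (at_right 0)"
    unfolding out_def[abs_def]
    by (intro tendsto_set_lebesgue_integral_at_right weighted_outside_integrable) auto
  then have "((\<lambda>\<delta>. tail \<delta> / \<bar>ln \<delta>\<bar> + (out \<delta> - far) / \<bar>ln \<delta>\<bar>) \<longlongrightarrow> ?L + 0) (at_right 0)"
    by (intro tendsto_add tail_asymptotics[OF \<eta>] tendsto_divide_0[OF tendsto_diff[OF _ tendsto_const] top])
  moreover have "\<forall>\<^sub>F \<delta> in at_right 0. tail \<delta> / \<bar>ln \<delta>\<bar> + (out \<delta> - far) / \<bar>ln \<delta>\<bar>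
     = 1 / \<bar>ln \<delta>\<bar> * (LINT \<epsilon>:{\<delta>..1}|lborel. weighted_volume UNIV \<epsilon>)"
    unfolding eventually_at_right_field
  proof (intro exI[of _ 1] conjI allI impI)
    fix \<delta> :: real assume \<delta>: "0 < \<delta>" "\<delta> < 1"
    have "parallel_volume UNIV x = parallel_volume U x + parallel_volume (- U) x" for x
      using volume_Un[OF Q_sets(1,2), of x] by simp
    then have "(LINT \<epsilon>:{\<delta>..1}|lborel. weighted_volume UNIV \<epsilon>)
        = (LINT \<epsilon>:{\<delta>..1}|lborel. weighted_volume U \<epsilon> + weighted_volume (- U) \<epsilon>)"
      by (simp add: distrib_left)
    also have "\<dots> = (LINT \<epsilon>:{\<delta>..1}|lborel. weighted_volume U \<epsilon>) + out \<delta>"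
      unfolding out_def by (intro set_integral_add(2) weighted_volume_integrable_Icc Q_sets \<delta>)
    also have "(LINT \<epsilon>:{\<delta>..1}|lborel. weighted_volume U \<epsilon>) = tail \<delta> - far"
    proof -
      have split: "{\<delta>..} = {\<delta>..1} \<union> {1<..}" using \<delta> by auto
      have "set_integrable lborel {1<..} (weighted_volume U)"
        by (rule set_integrable_subset[OF weighted_tail_integrable[OF Q_sets(1) order_refl zero_less_one]]) auto
      then have "tail \<delta> = (LINT \<epsilon>:{\<delta>..1}|lborel. weighted_volume U \<epsilon>) + far"
        unfolding tail_def far_def split
        by (intro set_integral_Un weighted_volume_integrable_Icc Q_sets \<delta>) auto
      then show ?thesis by simp
    qed
    finally show "tail \<delta> / \<bar>ln \<delta>\<bar> + (out \<delta> - far) / \<bar>ln \<delta>\<bar>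
     = 1 / \<bar>ln \<delta>\<bar> * (LINT \<epsilon>:{\<delta>..1}|lborel. weighted_volume UNIV \<epsilon>)"
      by (simp add: add_divide_distrib diff_divide_distrib)
  qed simp
  ultimately show ?thesis by (simp add: filterlim_cong)
qed

end

theorem theorem3p15:
  fixes N :: nat
    and S :: "nat \<Rightarrow> real ^ 'd \<Rightarrow> real ^ 'd"
    and r :: "nat \<Rightarrow> real"
    and F :: "(real ^ 'd) set"
    and D \<eta> :: real
  assumes ifs: "similarity_ifs N S r"
    and F: "self_similar_set N S F"
    and OSC: "open_set_condition N S"
    and D: "similarity_dimension N r D"
    and D_less: "D < real CARD('d)"
    and \<eta>: "\<eta> = - (\<Sum>i=1..N. r i powr D * ln (r i))"
  shows "\<exists>U. strong_feasible_open_set N S F U \<and>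
    (let \<Gamma> = U - ifs_image N S U;
         f = (\<lambda>\<epsilon>. \<epsilon> powr (D - real CARD('d) - 1) * measure lebesgue (parallel_set F \<epsilon> \<inter> \<Gamma>));
         M = ereal (1 / \<eta> * (LINT \<epsilon>:{0<..}|lborel. f \<epsilon>))
     in set_integrable lborel {0<..} f \<and>
        has_average_minkowski_content D F M \<and>
        (\<forall>M'. has_minkowski_content D F M' \<longrightarrow> M' = M))"
proof -
  interpret similarity_system N S r F by standard (fact ifs F)+
  obtain U k where U: "feasible_open_set N S U" "k \<in> words" "word_map S k ` F \<subseteq> U"
    "\<And>i z. i \<in> {1..N} \<Longrightarrow> z \<in> S i ` U \<Longrightarrow> infdist z F = infdist z (S i ` F)"
    using strong_open_set_with_projection[OF OSC] by metis
  interpret projecting_open_set N S r F D U k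
    by standard (fact D D_less U)+
  define u where "u \<epsilon> = \<epsilon> powr (D - real CARD('d)) * measure lebesgue (parallel_set F \<epsilon>)" for \<epsilon>
  define m where "m = 1 / \<eta> * (LINT \<epsilon>:{0<..}|lborel. weighted_volume \<Gamma> \<epsilon>)"
  have u: "u \<epsilon> / \<epsilon> = weighted_volume UNIV \<epsilon>" if "0 < \<epsilon>" for \<epsilon>
    using that by (simp add: u_def parallel_volume_def powr_diff)
  have u_int: "(LINT \<epsilon>:{\<delta>..1}|lborel. u \<epsilon> / \<epsilon>) = (LINT \<epsilon>:{\<delta>..1}|lborel. weighted_volume UNIV \<epsilon>)" if "0 < \<delta>" for \<delta>
    using that u by (intro set_lebesgue_integral_cong) auto
  have "\<forall>\<^sub>F \<delta> in at_right 0. 1 / \<bar>ln \<delta>\<bar> * (LINT \<epsilon>:{\<delta>..1}|lborel. weighted_volume UNIV \<epsilon>)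
      = 1 / \<bar>ln \<delta>\<bar> * (LINT \<epsilon>:{\<delta>..1}|lborel. u \<epsilon> / \<epsilon>)"
    unfolding eventually_at_right_field by (intro exI[of _ 1]) (auto simp: u_int)
  with average_content[OF \<eta>]
  have lim: "((\<lambda>\<delta>. 1 / \<bar>ln \<delta>\<bar> * (LINT \<epsilon>:{\<delta>..1}|lborel. u \<epsilon> / \<epsilon>)) \<longlongrightarrow> m) (at_right 0)"
    unfolding m_def by (rule Lim_transform_eventually)
  have int: "set_integrable lborel {\<delta>..1} (\<lambda>\<epsilon>. u \<epsilon> / \<epsilon>)" if "0 < \<delta>" for \<delta>
  proof -
    have "set_integrable lborel {\<delta>..1} (weighted_volume UNIV)"
      using that by (intro weighted_volume_integrable_Icc) auto
    then show ?thesis using that u by (subst set_integrable_cong[OF refl refl]) auto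
  qed
  have "strong_feasible_open_set N S F U"
    unfolding strong_feasible_open_set_def using U word_map_F F_nonempty by blast
  moreover have "has_average_minkowski_content D F (ereal m)"
    unfolding has_average_minkowski_content_def using lim by (simp add: u_def)
  moreover have "M' = ereal m" if "has_minkowski_content D F M'" for M'
    using log_average_eq_limit[OF int _ lim] that unfolding has_minkowski_content_def u_def[symmetric]
    by blast
  ultimately show ?thesis
    using weighted_generator_integrable unfolding Let_def
    by (intro exI[of _ U]) (auto simp: m_def parallel_volume_def)
qed

end
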